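(* Assume that $\varphi$ is non-contractive, and let $(S,\iota)$ be a free analytic 1-submanifold of $M$ with $S\cong D$ (homeomorphic to an interval) and $S\notin\mathcal F(S)$. Let $z\in\mathrm{int}[S]$ and let $[g]$ be a $z$-decomposition of $S$, with corresponding segments $K_\pm$ and $\Sigma_\pm$. Then exactly one of the following two cases holds: (i) there is a boundary segment $C_+\in\mathcal F(S)$ of $\Sigma_+$ with $z\in\partial_{C_+}$ and $K_+\subseteq C_+$ such that $(\iota|_{C_+})^{-1}\circ(g\cdot\iota|_{\Sigma_-})\colon\Sigma_-\to C_+\subseteq\Sigma_+$ is an analytic diffeomorphism; (ii) there is a boundary segment $C_-\in\mathcal F(S)$ of $\Sigma_-$ with $C_-\subset\Sigma_-$ (proper), $z\in\partial_{C_-}$ and $K_-\subseteq C_-$ such that $(\iota|_{\Sigma_+})^{-1}\circ(g\cdot\iota|_{C_-})\colon C_-\to\Sigma_+$ is an analytic diffeomorphism.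
   Context: Manifolds and Lie groups are finite-dimensional, Hausdorff, real analytic, without boundary unless stated otherwise, and not assumed second countable. $\varphi\colon G\times M\to M$, $(g,x)\mapsto g\cdot x$, is a left action of a Lie group $G$ on an analytic manifold $M$ such that $g\mapsto g\cdot x$ is continuous for each $x\in M$. $\varphi$ is analytic in $M$ if $x\mapsto g\cdot x$ is analytic for each $g\in G$; it is non-contractive if it is analytic in $M$ and for each $C\subseteq M$ with $|C|\ge 2$ and each $x\in M\setminus C$ there is a neighbourhood $U$ of $x$ with $g\cdot C\not\subseteq U$ for all $g\in G$. An analytic 1-submanifold $(S,\iota)$ of $M$ consists of a connected, Hausdorff, second countable 1-dimensional analytic manifold $S$ with (possibly empty) boundary and an injective analytic immersion $\iota\colon S\to M$. $S\cong D$ means that there is a homeomorphism $\upsilon\colon D\to S$ with $D\subseteq\mathbb R$ a nondegenerate interval. A segment is a connected subset of $S$ with more than one point; $\mathrm{Seg}(S)$ is the set of segments. For $\Sigma\in\mathrm{Seg}(S)$: $\mathrm{int}[\Sigma]:=\upsilon(\text{interior of }\upsilon^{-1}(\Sigma)\text{ in }\mathbb R)$ and $\partial_\Sigma:=\Sigma\setminus\mathrm{int}[\Sigma]$. Each segment is regarded as an analytic 1-manifold with boundary $\partial_\Sigma$, embedded in $S$; an analytic diffeomorphism between segments is a homeomorphism such that it and its inverse are analytic (immersive). A boundary segment of $\Sigma$ is a segment $\Sigma'\subseteq\Sigma$ with $\Sigma\setminus\Sigma'$ connected (possibly empty). $g\cdot\iota$ denotes $z\mapsto g\cdot\iota(z)$;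 $G_x$ is the stabilizer of $x\in M$, $G_z:=G_{\iota(z)}$ for $z\in S$, $G_S:=\bigcap_{z\in S}G_{\iota(z)}$, $\mathcal H(S):=G/G_S$ (left cosets), and $[g]\in\mathcal H(S)$ is the class of $g$. For $\Sigma,\Sigma'\in\mathrm{Seg}(S)$ and $g\in G$, write $g\cdot\iota|_\Sigma\sim_\circ\iota|_{\Sigma'}$ if $g\cdot\iota(O)=\iota(O')$ for open (in $S$) segments $O\subseteq\Sigma$, $O'\subseteq\Sigma'$ on which $\iota$ is an embedding. $\Sigma\in\mathrm{Seg}(S)$ is a free segment, $\Sigma\in\mathcal F(S)$, if for $g\in G$: $g\cdot\iota|_\Sigma\sim_\circ\iota|_\Sigma\Leftrightarrow g\in G_S$. $(S,\iota)$ is free if $\mathcal F(S)\neq\emptyset$. $z$-decomposition. For $S\cong D$ and $z\in\mathrm{int}[S]$, a $z$-decomposition of $S$ is a class $[e]\neq[g]\in\mathcal H(S)$ with $g\in G_z$ such that (a) there are compact segments $K_\pm\subseteq S$ with $g\cdot\iota(K_-)=\iota(K_+)$ and $K_-\cap K_+=\{z\}$; (b) $\Sigma_\pm\in\mathcal F(S)$ for the unique boundary segments $\Sigma_\pm$ of $S$ with $S=\Sigma_-\cup\Sigma_+$, $\Sigma_-\cap\Sigma_+=\partial_{\Sigma_-}\cap\partial_{\Sigma_+}=\{z\}$, $K_\pm\subseteq\Sigma_\pm$. *)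

theory Defs
  imports "HOL-Analysis.Analysis" "HOL-Algebra.Group_Action"
begin

section \<open>Real analytic functions and manifolds\<close>

text \<open>
  \<open>\<real>\<^sup>n\<close> is represented by \<^const>\<open>Euclidean_space\<close> \<open>n\<close>, whose points are the functions
  \<open>nat \<Rightarrow> real\<close> vanishing at all indices \<open>\<ge> n\<close>; this keeps dimension \<open>0\<close>
  (for example discrete groups) available. Analyticity is local representability by a power series
  indexed by the multi-indices \<open>\<alpha>\<close> supported in \<open>{..<n}\<close>. The identity is only required on \<open>D\<close>:
  for \<open>D\<close> open in a half-space (or an interval, if \<open>n = 1\<close>) the series converges on a full
  neighbourhood of \<open>x\<close>, so that this says that the function extends analytically around each point of \<open>D\<close>.
\<close>

definition real_analytic_on :: "nat \<Rightarrow> (nat \<Rightarrow> real) set \<Rightarrow> ((nat \<Rightarrow> real) \<Rightarrow> real) \<Rightarrow> bool" where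
  "real_analytic_on n D f \<longleftrightarrow>
     (\<forall>x\<in>D. \<exists>(a :: (nat \<Rightarrow> nat) \<Rightarrow> real) r. r > 0 \<and>
        (\<forall>y\<in>D. (\<forall>i<n. \<bar>y i - x i\<bar> < r) \<longrightarrow>
           ((\<lambda>\<alpha>. a \<alpha> * (\<Prod>i<n. (y i - x i) ^ \<alpha> i)) has_sum f y) {\<alpha>. \<forall>i\<ge>n. \<alpha> i = 0}))"

definition Half_space :: "nat \<Rightarrow> (nat \<Rightarrow> real) topology" where
  "Half_space n = subtopology (Euclidean_space n) {x. 0 \<le> x 0}"

type_synonym 'a chart = "'a set \<times> ('a \<Rightarrow> nat \<Rightarrow> real)"

definition is_chart :: "(nat \<Rightarrow> real) topology \<Rightarrow> 'a::topological_space chart \<Rightarrow> bool" where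
  "is_chart E = (\<lambda>(U, c). open U \<and> openin E (c ` U) \<and>
     homeomorphic_map (top_of_set U) (subtopology E (c ` U)) c)"

text \<open>
  A manifold is carried by a whole Hausdorff type together with an atlas, which need not be maximal.
  The model space \<open>E\<close> is \<^const>\<open>Euclidean_space\<close> \<open>n\<close> (no boundary) or \<^const>\<open>Half_space\<close> \<open>n\<close>
  (possibly empty boundary).
\<close>

definition analytic_manifold ::
    "nat \<Rightarrow> (nat \<Rightarrow> real) topology \<Rightarrow> 'a::t2_space chart set \<Rightarrow> bool" where
  "analytic_manifold n E A \<longleftrightarrow>
     (\<forall>k\<in>A. is_chart E k) \<and> (\<Union>(U, c)\<in>A. U) = UNIV \<and>
     (\<forall>(U, c)\<in>A. \<forall>(V, d)\<in>A. \<forall>j<n.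
        real_analytic_on n (c ` (U \<inter> V)) (\<lambda>t. d (inv_into U c t) j))"

text \<open>
  Analyticity of a map on a subset \<open>Z\<close> of the \<open>n\<close>-dimensional source. Besides \<open>Z = UNIV\<close>, this is used
  for segments \<open>Z\<close> of a 1-manifold, whose analytic structure is obtained by restricting charts.
\<close>

definition analytic_map_on ::
    "nat \<Rightarrow> 'a::topological_space chart set \<Rightarrow> nat \<Rightarrow> 'b::topological_space chart set
      \<Rightarrow> 'a set \<Rightarrow> ('a \<Rightarrow> 'b) \<Rightarrow> bool" where
  "analytic_map_on n A m B Z f \<longleftrightarrow> continuous_on Z f \<and>
     (\<forall>(U, c)\<in>A. \<forall>(V, d)\<in>B. \<forall>j<m.
        real_analytic_on n (c ` (U \<inter> Z \<inter> f -` V)) (\<lambda>t. d (f (inv_into U c t)) j))"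

definition line_pt :: "real \<Rightarrow> nat \<Rightarrow> real" where
  "line_pt s = (\<lambda>i. if i = 0 then s else 0)"

text \<open>
  Immersivity for a 1-dimensional source: the derivative of the coordinate representation
  (one-sided at boundary points) does not vanish.
\<close>

definition immersive_on ::
    "'a::topological_space chart set \<Rightarrow> nat \<Rightarrow> 'b::topological_space chart set
      \<Rightarrow> 'a set \<Rightarrow> ('a \<Rightarrow> 'b) \<Rightarrow> bool" where
  "immersive_on A m B Z f \<longleftrightarrow>
     (\<forall>(U, c)\<in>A. \<forall>(V, d)\<in>B. \<forall>z\<in>U \<inter> Z \<inter> f -` V. \<exists>j<m. \<exists>D. D \<noteq> 0 \<and>
        ((\<lambda>s. d (f (inv_into U c (line_pt s))) j) has_real_derivative D)
          (at (c z 0) within {s. line_pt s \<in> c ` (U \<inter> Z \<inter> f -` V)}))"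


section \<open>Lie groups and actions\<close>

definition prod_atlas :: "nat \<Rightarrow> 'a chart set \<Rightarrow> 'b chart set \<Rightarrow> ('a \<times> 'b) chart set" where
  "prod_atlas n A B =
     {(U \<times> V, \<lambda>(x, y) i. if i < n then c x i else d y (i - n)) | U c V d. (U, c) \<in> A \<and> (V, d) \<in> B}"

definition lie_group :: "nat \<Rightarrow> ('g::t2_space, 'b) monoid_scheme \<Rightarrow> 'g chart set \<Rightarrow> bool" where
  "lie_group n G A \<longleftrightarrow> group G \<and> carrier G = UNIV \<and>
     analytic_manifold n (Euclidean_space n) A \<and>
     analytic_map_on (n + n) (prod_atlas n A A) n A UNIV (\<lambda>(g, h). g \<otimes>\<^bsub>G\<^esub> h) \<and>
     analytic_map_on n A n A UNIV (\<lambda>g. inv\<^bsub>G\<^esub> g)"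

definition pointwise_continuous_action ::
    "('g::t2_space, 'b) monoid_scheme \<Rightarrow> ('g \<Rightarrow> 'm::t2_space \<Rightarrow> 'm) \<Rightarrow> bool" where
  "pointwise_continuous_action G \<phi> \<longleftrightarrow>
     group_action G UNIV \<phi> \<and> (\<forall>x. continuous_on (carrier G) (\<lambda>g. \<phi> g x))"

definition analytic_in_space ::
    "('g, 'b) monoid_scheme \<Rightarrow> nat \<Rightarrow> 'm::t2_space chart set \<Rightarrow> ('g \<Rightarrow> 'm \<Rightarrow> 'm) \<Rightarrow> bool" where
  "analytic_in_space G m B \<phi> \<longleftrightarrow> (\<forall>g\<in>carrier G. analytic_map_on m B m B UNIV (\<phi> g))"

definition non_contractive ::
    "('g, 'b) monoid_scheme \<Rightarrow> nat \<Rightarrow> 'm::t2_space chart set \<Rightarrow> ('g \<Rightarrow> 'm \<Rightarrow> 'm) \<Rightarrow> bool" where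
  "non_contractive G m B \<phi> \<longleftrightarrow> analytic_in_space G m B \<phi> \<and>
     (\<forall>C x. (\<exists>a\<in>C. \<exists>b\<in>C. a \<noteq> b) \<and> x \<notin> C \<longrightarrow>
        (\<exists>U. open U \<and> x \<in> U \<and> (\<forall>g\<in>carrier G. \<not> \<phi> g ` C \<subseteq> U)))"


section \<open>Analytic 1-submanifolds and segments\<close>

definition analytic_1_submanifold ::
    "nat \<Rightarrow> 'm::t2_space chart set \<Rightarrow> 's::{t2_space, second_countable_topology} chart set
      \<Rightarrow> ('s \<Rightarrow> 'm) \<Rightarrow> bool" where
  "analytic_1_submanifold m B A \<iota> \<longleftrightarrow>
     connected (UNIV :: 's set) \<and> analytic_manifold 1 (Half_space 1) A \<and>
     inj \<iota> \<and> analytic_map_on 1 A m B UNIV \<iota> \<and> immersive_on A m B UNIV \<iota>"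

definition is_interval_param :: "real set \<Rightarrow> (real \<Rightarrow> 's::topological_space) \<Rightarrow> bool" where
  "is_interval_param D \<upsilon> \<longleftrightarrow> is_interval D \<and> (\<exists>a\<in>D. \<exists>b\<in>D. a \<noteq> b) \<and>
     homeomorphic_map (top_of_set D) euclidean \<upsilon>"

definition segment :: "'s::topological_space set \<Rightarrow> bool" where
  "segment \<Sigma> \<longleftrightarrow> connected \<Sigma> \<and> (\<exists>x\<in>\<Sigma>. \<exists>y\<in>\<Sigma>. x \<noteq> y)"

text \<open>
  The interior is taken in \<open>\<real>\<close>, not in \<open>D\<close>: boundary points of the ambient 1-manifold that lie in a
  segment belong to the boundary of the segment.
\<close>

definition seg_interior :: "real set \<Rightarrow> (real \<Rightarrow> 's) \<Rightarrow> 's set \<Rightarrow> 's set" where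
  "seg_interior D \<upsilon> \<Sigma> = \<upsilon> ` interior (D \<inter> \<upsilon> -` \<Sigma>)"

definition seg_boundary :: "real set \<Rightarrow> (real \<Rightarrow> 's) \<Rightarrow> 's set \<Rightarrow> 's set" where
  "seg_boundary D \<upsilon> \<Sigma> = \<Sigma> - seg_interior D \<upsilon> \<Sigma>"

definition boundary_segment :: "'s::topological_space set \<Rightarrow> 's set \<Rightarrow> bool" where
  "boundary_segment \<Sigma>' \<Sigma> \<longleftrightarrow> segment \<Sigma>' \<and> \<Sigma>' \<subseteq> \<Sigma> \<and> connected (\<Sigma> - \<Sigma>')"

definition analytic_diffeo ::
    "'s::topological_space chart set \<Rightarrow> 's set \<Rightarrow> 's set \<Rightarrow> ('s \<Rightarrow> 's) \<Rightarrow> bool" where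
  "analytic_diffeo A \<Sigma> \<Sigma>' f \<longleftrightarrow> (\<exists>h. homeomorphism \<Sigma> \<Sigma>' f h \<and>
     analytic_map_on 1 A 1 A \<Sigma> f \<and> immersive_on A 1 A \<Sigma> f \<and>
     analytic_map_on 1 A 1 A \<Sigma>' h \<and> immersive_on A 1 A \<Sigma>' h)"


section \<open>Free segments and decompositions\<close>

definition stab_curve ::
    "('g, 'b) monoid_scheme \<Rightarrow> ('g \<Rightarrow> 'm \<Rightarrow> 'm) \<Rightarrow> ('s \<Rightarrow> 'm) \<Rightarrow> 'g set" where
  "stab_curve G \<phi> \<iota> = (\<Inter>z. stabilizer G \<phi> (\<iota> z))"

text \<open>As \<open>\<iota>\<close> is an immersion, it is an embedding on \<open>O\<close> iff it is a homeomorphism onto \<open>\<iota>(O)\<close> there.\<close>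

definition overlaps ::
    "('g \<Rightarrow> 'm::topological_space \<Rightarrow> 'm) \<Rightarrow> ('s::topological_space \<Rightarrow> 'm)
      \<Rightarrow> 'g \<Rightarrow> 's set \<Rightarrow> 's set \<Rightarrow> bool" where
  "overlaps \<phi> \<iota> g \<Sigma> \<Sigma>' \<longleftrightarrow> (\<exists>W W'.
     open W \<and> segment W \<and> W \<subseteq> \<Sigma> \<and> embedding_map (top_of_set W) euclidean \<iota> \<and>
     open W' \<and> segment W' \<and> W' \<subseteq> \<Sigma>' \<and> embedding_map (top_of_set W') euclidean \<iota> \<and>
     \<phi> g ` \<iota> ` W = \<iota> ` W')"

definition free_segments ::
    "('g, 'b) monoid_scheme \<Rightarrow> ('g \<Rightarrow> 'm::topological_space \<Rightarrow> 'm)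
      \<Rightarrow> ('s::topological_space \<Rightarrow> 'm) \<Rightarrow> 's set set" where
  "free_segments G \<phi> \<iota> =
     {\<Sigma>. segment \<Sigma> \<and> (\<forall>g\<in>carrier G. overlaps \<phi> \<iota> g \<Sigma> \<Sigma> \<longleftrightarrow> g \<in> stab_curve G \<phi> \<iota>)}"

definition free_curve ::
    "('g, 'b) monoid_scheme \<Rightarrow> ('g \<Rightarrow> 'm::topological_space \<Rightarrow> 'm)
      \<Rightarrow> ('s::topological_space \<Rightarrow> 'm) \<Rightarrow> bool" where
  "free_curve G \<phi> \<iota> \<longleftrightarrow> free_segments G \<phi> \<iota> \<noteq> {}"

text \<open>
  The class of \<open>g\<close> in \<open>G/G\<^sub>S\<close> is a \<open>z\<close>-decomposition with corresponding segments \<open>K\<^sub>\<plusminus>\<close>, \<open>\<Sigma>\<^sub>\<plusminus>\<close>;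
  the conditions do not depend on the representative \<open>g\<close>. The segments \<open>\<Sigma>\<^sub>\<plusminus>\<close> are determined
  by \<open>z\<close> and \<open>K\<^sub>\<plusminus>\<close>.
\<close>

definition z_decomposition ::
    "('g, 'b) monoid_scheme \<Rightarrow> ('g \<Rightarrow> 'm::topological_space \<Rightarrow> 'm)
      \<Rightarrow> ('s::topological_space \<Rightarrow> 'm) \<Rightarrow> real set \<Rightarrow> (real \<Rightarrow> 's)
      \<Rightarrow> 's \<Rightarrow> 'g \<Rightarrow> 's set \<Rightarrow> 's set \<Rightarrow> 's set \<Rightarrow> 's set \<Rightarrow> bool" where
  "z_decomposition G \<phi> \<iota> D \<upsilon> z g Km Kp \<Sigma>m \<Sigma>p \<longleftrightarrow>
     g \<in> stabilizer G \<phi> (\<iota> z) \<and>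
     g <#\<^bsub>G\<^esub> stab_curve G \<phi> \<iota> \<noteq> \<one>\<^bsub>G\<^esub> <#\<^bsub>G\<^esub> stab_curve G \<phi> \<iota> \<and>
     segment Km \<and> compact Km \<and> segment Kp \<and> compact Kp \<and>
     \<phi> g ` \<iota> ` Km = \<iota> ` Kp \<and> Km \<inter> Kp = {z} \<and>
     boundary_segment \<Sigma>m UNIV \<and> boundary_segment \<Sigma>p UNIV \<and>
     \<Sigma>m \<in> free_segments G \<phi> \<iota> \<and> \<Sigma>p \<in> free_segments G \<phi> \<iota> \<and>
     \<Sigma>m \<union> \<Sigma>p = UNIV \<and> \<Sigma>m \<inter> \<Sigma>p = {z} \<and>
     seg_boundary D \<upsilon> \<Sigma>m \<inter> seg_boundary D \<upsilon> \<Sigma>p = {z} \<and>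
     Km \<subseteq> \<Sigma>m \<and> Kp \<subseteq> \<Sigma>p"

end

theory Submission
  imports Defs "HOL-Complex_Analysis.Conformal_Mappings"
begin

text \<open>
  Parametrise \<open>\<Sigma>\<^sub>-\<close> by \<open>t \<mapsto> \<gamma> (-t)\<close> and \<open>\<Sigma>\<^sub>+\<close> by \<open>t \<mapsto> \<gamma> t\<close>, \<open>t \<ge> 0\<close>, both starting at \<open>z\<close>, and let \<open>h\<close> be the
  maximal continuous reparametrisation with \<open>g \<cdot> \<iota> (\<gamma> (-t)) = \<iota> (\<gamma> (h t))\<close>; it starts at \<open>0\<close> and is strictly
  increasing. If its domain or its range is everything, this is case (i) or case (ii). Otherwise it ends at an inner
  point of both segments. There an immersed coordinate of \<open>\<iota>\<close> has a local holomorphic inverse, so that \<open>h\<close> is locally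
  the restriction of a holomorphic function, and by the identity theorem the equation persists beyond the end point,
  contradicting maximality. The same local formula for \<open>g\<close> and \<open>g\<^sup>-\<^sup>1\<close> shows that the lift and its inverse are analytic,
  so that both derivatives are nonzero.
\<close>

section \<open>Holomorphic extensions of analytic functions\<close>

text \<open>\<open>\<iota>\<close> is an injective immersion but need not be an embedding:
  \<open>\<iota> (\<gamma> t)\<close> may come back arbitrarily close to an earlier point while
  \<open>t\<close> runs to an open end of its interval. So the inverse of
  \<open>t \<mapsto> \<iota> (\<gamma> t)\<close> can be discontinuous, and continuity of
  \<open>h\<close> has to be part of the maximality condition. The compact segments
  \<open>Km\<close> and \<open>Kp\<close> supply a first nondegenerate piece of \<open>h\<close>,
  because \<open>\<iota>\<close> restricts to a homeomorphism onto its image on a compact set. If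
  neither domain nor range is exhausted, a parameter beyond each of them confines \<open>t\<close>
  and \<open>h t\<close> to compact intervals; both then converge to parameters of the curve, and
  the equation survives in the limit since \<open>M\<close> is Hausdorff. The detour through complex
  functions is due to \<open>real_analytic_on\<close>, which speaks of values on \<open>D\<close>
  only: at a boundary point of \<open>S\<close> the data are one-sided, whereas a holomorphic
  extension lives on a full disc, where local inverses and the identity theorem are
  available.\<close>

text \<open>
  The corner points make the power series absolutely convergent on a complex polydisc. They exist if \<open>D\<close> is open,
  but also for the one-dimensional pieces of half-lines that occur at boundary points.
\<close>

lemma analytic_compose_curve:
  fixes \<gamma> :: "nat \<Rightarrow> complex \<Rightarrow> complex"
  assumes an: "real_analytic_on n D f" and x: "x \<in> D"
    and corner: "\<And>r. r > 0 \<Longrightarrow> \<exists>p\<in>D. \<forall>i<n. 0 < \<bar>p i - x i\<bar> \<and> \<bar>p i - x i\<bar> < r"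
    and R: "R > 0" and hol: "\<And>i. i < n \<Longrightarrow> \<gamma> i holomorphic_on ball (of_real t0) R"
    and \<gamma>0: "\<And>i. i < n \<Longrightarrow> \<gamma> i (of_real t0) = of_real (x i)"
  obtains F r where "0 < r" "r \<le> R" "F holomorphic_on ball (of_real t0) r"
    "\<And>s y. \<bar>s - t0\<bar> < r \<Longrightarrow> y \<in> D \<Longrightarrow> (\<And>i. i < n \<Longrightarrow> \<gamma> i (of_real s) = of_real (y i))
       \<Longrightarrow> F (of_real s) = of_real (f y)"
proof -
  define I where "I = {\<alpha> :: nat \<Rightarrow> nat. \<forall>i\<ge>n. \<alpha> i = 0}"
  from an x obtain a r0 where r0: "r0 > 0"
    and ser: "\<And>y. y \<in> D \<Longrightarrow> (\<forall>i<n. \<bar>y i - x i\<bar> < r0) \<Longrightarrow>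
       ((\<lambda>\<alpha>. a \<alpha> * (\<Prod>i<n. (y i - x i) ^ \<alpha> i)) has_sum f y) I"
    unfolding real_analytic_on_def I_def by blast
  obtain p where p: "p \<in> D" "\<And>i. i < n \<Longrightarrow> 0 < \<bar>p i - x i\<bar>" "\<And>i. i < n \<Longrightarrow> \<bar>p i - x i\<bar> < r0"
    using corner[OF r0] by blast
  define \<rho> where "\<rho> = (\<lambda>i. \<bar>p i - x i\<bar>)"
  define M where "M = (\<lambda>\<alpha>. \<bar>a \<alpha>\<bar> * (\<Prod>i<n. \<rho> i ^ \<alpha> i))"
  have "(\<lambda>\<alpha>. a \<alpha> * (\<Prod>i<n. (p i - x i) ^ \<alpha> i)) summable_on I"
    using ser[OF p(1)] p(3) has_sum_imp_summable by blast
  \<comment> \<open>\<open>has_sum\<close> is unordered, so convergence of the real terms at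
    \<open>p\<close> is already absolute; this is what lets \<open>M\<close> dominate the complex
    terms.\<close>
  then have "(\<lambda>\<alpha>. norm (a \<alpha> * (\<Prod>i<n. (p i - x i) ^ \<alpha> i))) summable_on I"
    by (rule summable_on_iff_abs_summable_on_real[THEN iffD1])
  then have Msum: "M summable_on I"
    by (simp add: M_def \<rho>_def abs_mult abs_prod power_abs)
  have "\<forall>i\<in>{..<n}. eventually (\<lambda>w. w \<in> ball (of_real t0) R \<and> norm (\<gamma> i w - of_real (x i)) < \<rho> i) (nhds (of_real t0))"
  proof
    fix i assume "i \<in> {..<n}"
    then have i: "i < n" by simp
    have "continuous_on (ball (of_real t0) R) (\<gamma> i)"
      using hol[OF i] holomorphic_on_imp_continuous_on by blast
    then have "isCont (\<gamma> i) (of_real t0)"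
      using R by (simp add: continuous_on_eq_continuous_at)
    then have "isCont (\<lambda>w. norm (\<gamma> i w - of_real (x i))) (of_real t0)"
      by (intro continuous_intros)
    then have "((\<lambda>w. norm (\<gamma> i w - of_real (x i))) \<longlongrightarrow> norm (\<gamma> i (of_real t0) - of_real (x i))) (nhds (of_real t0))"
      unfolding isCont_def by (rule tendsto_at_iff_tendsto_nhds[THEN iffD1])
    moreover have "norm (\<gamma> i (of_real t0) - of_real (x i)) < \<rho> i"
      using \<gamma>0[OF i] p(2)[OF i] by (simp add: \<rho>_def)
    ultimately have "eventually (\<lambda>w. norm (\<gamma> i w - of_real (x i)) < \<rho> i) (nhds (of_real t0))"
      by (rule order_tendstoD)
    moreover have "eventually (\<lambda>w. w \<in> ball (of_real t0 :: complex) R) (nhds (of_real t0))"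
      by (rule eventually_nhds_in_open) (use R in auto)
    ultimately show "eventually (\<lambda>w. w \<in> ball (of_real t0) R \<and> norm (\<gamma> i w - of_real (x i)) < \<rho> i) (nhds (of_real t0))"
      by eventually_elim simp
  qed
  then have "eventually (\<lambda>w. \<forall>i\<in>{..<n}. w \<in> ball (of_real t0) R \<and> norm (\<gamma> i w - of_real (x i)) < \<rho> i) (nhds (of_real t0))"
    by (intro eventually_ball_finite) auto
  then obtain r1 where r1: "r1 > 0"
    "\<And>w i. dist w (of_real t0) < r1 \<Longrightarrow> i < n \<Longrightarrow> norm (\<gamma> i w - of_real (x i)) < \<rho> i"
    unfolding eventually_nhds_metric by blast
  define r where "r = min (r1 / 2) (R / 2)"
  have r: "r > 0" "r < r1" "r < R" using r1 R by (auto simp: r_def)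
  define T where "T = (\<lambda>\<alpha> w. of_real (a \<alpha>) * (\<Prod>i<n. (\<gamma> i w - of_real (x i)) ^ \<alpha> i))"
  define F where "F = (\<lambda>w. \<Sum>\<^sub>\<infinity>\<alpha>\<in>I. T \<alpha> w)"
  have sub: "cball (complex_of_real t0) r \<subseteq> ball (of_real t0) R" using r by auto
  have "uniform_limit (cball (of_real t0) r) (\<lambda>X w. \<Sum>\<alpha>\<in>X. T \<alpha> w) F (finite_subsets_at_top I)"
    unfolding F_def
  proof (rule Weierstrass_m_test_general[OF _ Msum])
    fix \<alpha> w assume w: "w \<in> cball (complex_of_real t0) r"
    have "norm (T \<alpha> w) = \<bar>a \<alpha>\<bar> * (\<Prod>i<n. norm (\<gamma> i w - of_real (x i)) ^ \<alpha> i)"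
      by (simp add: T_def norm_mult prod_norm[symmetric] norm_power)
    also have "\<dots> \<le> M \<alpha>"
      unfolding M_def using r1(2)[of w] w r
      by (intro mult_left_mono prod_mono conjI power_mono) (auto simp: dist_commute less_imp_le)
    finally show "norm (T \<alpha> w) \<le> M \<alpha>" .
  qed
  moreover have Tcont: "T \<alpha> holomorphic_on ball (of_real t0) R" for \<alpha>
    unfolding T_def by (intro holomorphic_intros hol) auto
  have "\<forall>\<^sub>F X in finite_subsets_at_top I. continuous_on (cball (of_real t0) r) (\<lambda>w. \<Sum>\<alpha>\<in>X. T \<alpha> w)
      \<and> (\<lambda>w. \<Sum>\<alpha>\<in>X. T \<alpha> w) holomorphic_on ball (of_real t0) r"
  proof (rule always_eventually, rule allI)
    fix X
    have "(\<lambda>w. \<Sum>\<alpha>\<in>X. T \<alpha> w) holomorphic_on cball (of_real t0) r"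
      by (intro holomorphic_intros holomorphic_on_subset[OF Tcont sub])
    then show "continuous_on (cball (of_real t0) r) (\<lambda>w. \<Sum>\<alpha>\<in>X. T \<alpha> w)
      \<and> (\<lambda>w. \<Sum>\<alpha>\<in>X. T \<alpha> w) holomorphic_on ball (of_real t0) r"
      using holomorphic_on_imp_continuous_on holomorphic_on_subset ball_subset_cball by blast
  qed
  ultimately have Fhol: "F holomorphic_on ball (of_real t0) r"
    using holomorphic_uniform_limit[of "of_real t0" r "\<lambda>X w. \<Sum>\<alpha>\<in>X. T \<alpha> w" "finite_subsets_at_top I" F]
    by (metis finite_subsets_at_top_neq_bot)
  show thesis
  proof (rule that[of r F])
    fix s y assume s: "\<bar>s - t0\<bar> < r" and y: "y \<in> D"
      and eq: "\<And>i. i < n \<Longrightarrow> \<gamma> i (of_real s) = of_real (y i)"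
    have "\<bar>y i - x i\<bar> < r0" if i: "i < n" for i
    proof -
      have "dist (complex_of_real s) (of_real t0) < r1"
        using s r by (simp add: dist_norm flip: of_real_diff)
      then have "norm (\<gamma> i (of_real s) - of_real (x i)) < \<rho> i" using r1(2) i by blast
      then have "norm (complex_of_real (y i - x i)) < \<rho> i" by (simp add: eq[OF i])
      then have "\<bar>y i - x i\<bar> < \<rho> i" by (simp only: norm_of_real)
      then show ?thesis using p(3)[OF i] by (simp add: \<rho>_def)
    qed
    then have "((\<lambda>\<alpha>. a \<alpha> * (\<Prod>i<n. (y i - x i) ^ \<alpha> i)) has_sum f y) I"
      using ser y by blast
    then have "((\<lambda>\<alpha>. complex_of_real (a \<alpha> * (\<Prod>i<n. (y i - x i) ^ \<alpha> i))) has_sum of_real (f y)) I"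
      by (rule has_sum_of_real)
    moreover have "complex_of_real (a \<alpha> * (\<Prod>i<n. (y i - x i) ^ \<alpha> i)) = T \<alpha> (of_real s)" for \<alpha>
      by (simp add: T_def eq)
    ultimately show "F (of_real s) = of_real (f y)"
      by (simp add: F_def infsumI)
  qed (use r Fhol in auto)
qed

text \<open>The Taylor series of \<open>F\<close> is the required series once multi-indices
  supported at \<open>0\<close> are identified with natural numbers. This is the way back from
  holomorphic extensions to the given notion of analyticity.\<close>

lemma real_analytic_on_1I:
  assumes "\<And>x. x \<in> D \<Longrightarrow> \<exists>F r. 0 < r \<and> F holomorphic_on ball (of_real (x 0)) r \<and>
     (\<forall>y\<in>D. \<bar>y 0 - x 0\<bar> < r \<longrightarrow> F (of_real (y 0)) = of_real (f y))"
  shows "real_analytic_on 1 D f"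
  unfolding real_analytic_on_def
proof
  fix x assume "x \<in> D"
  then obtain F r where r: "0 < r" and hol: "F holomorphic_on ball (of_real (x 0)) r"
    and eq: "\<And>y. y \<in> D \<Longrightarrow> \<bar>y 0 - x 0\<bar> < r \<Longrightarrow> F (of_real (y 0)) = of_real (f y)"
    using assms by blast
  \<comment> \<open>Reality of \<open>F\<close> off \<open>D\<close> is not at issue: powers of real
    increments are real, so taking real parts of the coefficients takes the real part of the sum,
    which is already \<open>f y\<close>.\<close>
  define b where "b = (\<lambda>k. Re ((deriv ^^ k) F (of_real (x 0)) / fact k))"
  have bij: "bij_betw (\<lambda>\<alpha>. \<alpha> 0) {\<alpha> :: nat \<Rightarrow> nat. \<forall>i\<ge>1. \<alpha> i = 0} UNIV"
  proof (rule bij_betw_byWitness[where f' = "\<lambda>k i. if i = 0 then k else 0"])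
    show "\<forall>\<alpha>\<in>{\<alpha> :: nat \<Rightarrow> nat. \<forall>i\<ge>1. \<alpha> i = 0}. (\<lambda>i. if i = 0 then \<alpha> 0 else 0) = \<alpha>"
      by (auto simp: fun_eq_iff)
  qed auto
  have "((\<lambda>\<alpha>. b (\<alpha> 0) * (\<Prod>i<1. (y i - x i) ^ \<alpha> i)) has_sum f y) {\<alpha>. \<forall>i\<ge>1. \<alpha> i = 0}"
    if y: "y \<in> D" and near: "\<forall>i<1. \<bar>y i - x i\<bar> < r / 2" for y
  proof -
    have d: "\<bar>y 0 - x 0\<bar> < r / 2" using near by simp
    define c where "c = (\<lambda>k. (deriv ^^ k) F (of_real (x 0)) / fact k)"
    \<comment> \<open>The unordered sum needs absolute convergence. It is obtained strictly inside
      radius \<open>r / 2\<close> from convergence at the point at distance exactly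
      \<open>r / 2\<close>.\<close>
    have sums: "(\<lambda>k. c k * (w - of_real (x 0)) ^ k) sums F w" if "w \<in> ball (of_real (x 0)) r" for w
      unfolding c_def using holomorphic_power_series[OF hol that] by simp
    define h where "h = complex_of_real (r / 2)"
    have hr: "summable (\<lambda>k. c k * h ^ k)"
      using sums[of "of_real (x 0) + h"] r
      by (auto simp: h_def dist_norm summable_def)
    have "norm (of_real (y 0) - complex_of_real (x 0)) < norm h"
      using d by (simp add: h_def flip: of_real_diff)
    then have abss: "summable (\<lambda>k. norm (c k * (of_real (y 0) - of_real (x 0)) ^ k))"
      using powser_insidea[OF hr] by blast
    have "complex_of_real (y 0) \<in> ball (of_real (x 0)) r"
      using d r by (simp add: dist_norm abs_minus_commute flip: of_real_diff)
    moreover have "F (of_real (y 0)) = of_real (f y)" using eq[OF y] d r by simp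
    ultimately have "(\<lambda>k. c k * (of_real (y 0) - of_real (x 0)) ^ k) sums of_real (f y)"
      using sums by metis
    then have "((\<lambda>k. c k * (of_real (y 0) - of_real (x 0)) ^ k) has_sum of_real (f y)) UNIV"
      using norm_summable_imp_has_sum[OF abss] by blast
    then have "((\<lambda>k. Re (c k * (of_real (y 0) - of_real (x 0)) ^ k)) has_sum f y) UNIV"
      by (auto dest: has_sum_Re)
    moreover have "Re (c k * (of_real (y 0) - of_real (x 0)) ^ k) = b k * (y 0 - x 0) ^ k" for k
    proof -
      have "b k = Re (c k)" by (simp add: b_def c_def)
      then show ?thesis by (simp flip: of_real_diff of_real_power)
    qed
    ultimately have "((\<lambda>k. b k * (y 0 - x 0) ^ k) has_sum f y) UNIV" by (simp only:)
    then have "((\<lambda>\<alpha>. b (\<alpha> 0) * (y 0 - x 0) ^ \<alpha> 0) has_sum f y) {\<alpha> :: nat \<Rightarrow> nat. \<forall>i\<ge>1. \<alpha> i = 0}"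
      using has_sum_reindex_bij_betw[OF bij, of "\<lambda>k. b k * (y 0 - x 0) ^ k" "f y"] by blast
    then show ?thesis by simp
  qed
  then show "\<exists>a r. r > 0 \<and> (\<forall>y\<in>D. (\<forall>i<1. \<bar>y i - x i\<bar> < r) \<longrightarrow>
           ((\<lambda>\<alpha>. a \<alpha> * (\<Prod>i<1. (y i - x i) ^ \<alpha> i)) has_sum f y) {\<alpha>. \<forall>i\<ge>1. \<alpha> i = 0})"
    using r by (intro exI[of _ "\<lambda>\<alpha>. b (\<alpha> 0)"] exI[of _ "r / 2"]) auto
qed

section \<open>Curves in charts\<close>

text \<open>Points of the model half-line are functions supported at index \<open>0\<close>, so
  evaluation at \<open>0\<close> inverts \<open>line_pt\<close>. Charts of the curve thereby become
  coordinates in a set of reals, where derivatives and limits are taken.\<close>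

lemma chart_homeomorphism:
  assumes "analytic_manifold 1 (Half_space 1) A" "(U, c) \<in> A"
  shows "homeomorphism U {s. line_pt s \<in> c ` U} (\<lambda>u. c u 0) (\<lambda>s. inv_into U c (line_pt s))"
    and "open U" and "inj_on c U" and "u \<in> U \<Longrightarrow> c u = line_pt (c u 0)"
proof -
  let ?E = "Half_space 1"
  have ch: "is_chart ?E (U, c)" using assms by (auto simp: analytic_manifold_def)
  then have hm: "homeomorphic_map (top_of_set U) (subtopology ?E (c ` U)) c" and U: "open U"
    and op: "openin ?E (c ` U)"
    by (auto simp: is_chart_def)
  show "open U" by fact
  show inj: "inj_on c U" using homeomorphic_imp_injective_map[OF hm] by simp
  have line: "c u = line_pt (c u 0)" if "u \<in> U" for u
  proof -
    have "c u \<in> topspace ?E" using op that openin_subset by blast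
    then show ?thesis by (auto simp: Half_space_def topspace_Euclidean_space line_pt_def fun_eq_iff)
  qed
  then show "u \<in> U \<Longrightarrow> c u = line_pt (c u 0)" .
  obtain g where g: "homeomorphic_maps (top_of_set U) (subtopology ?E (c ` U)) c g"
    using hm homeomorphic_map_maps by blast
  have gc: "g (c u) = u" if "u \<in> U" for u
    using g that by (simp add: homeomorphic_maps_def)
  have inv: "inv_into U c t = g t" if "t \<in> c ` U" for t
    using that gc inj by auto
  let ?T = "{s. line_pt s \<in> c ` U}"
  have cont: "continuous_on U (\<lambda>u. c u 0)"
  proof -
    have "continuous_map (top_of_set U) (powertop_real UNIV) c"
      using g by (auto simp: homeomorphic_maps_def Half_space_def Euclidean_space_def
          continuous_map_in_subtopology)
    then show ?thesis
      by (auto simp: continuous_map_componentwise_UNIV)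
  qed
  have contl: "continuous_map (top_of_set ?T) (subtopology ?E (c ` U)) line_pt"
  proof -
    have "continuous_map (top_of_set ?T) (powertop_real UNIV) line_pt"
      unfolding continuous_map_componentwise_UNIV
    proof
      fix k :: nat
      have "continuous_on ?T (\<lambda>x. if k = 0 then x else 0 :: real)" by (cases k) auto
      then show "continuous_map (top_of_set ?T) euclideanreal (\<lambda>x. line_pt x k)"
        by (simp add: line_pt_def)
    qed
    moreover have "line_pt s \<in> {x. \<forall>i\<ge>1. x i = 0}" for s by (auto simp: line_pt_def)
    moreover have "0 \<le> line_pt s 0" if "line_pt s \<in> c ` U" for s
      using that op openin_subset[OF op] by (auto simp: Half_space_def)
    ultimately show ?thesis
      by (auto simp: Half_space_def Euclidean_space_def continuous_map_in_subtopology)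
  qed
  have "continuous_map (top_of_set ?T) (top_of_set U) (g \<circ> line_pt)"
    using g contl continuous_map_compose by (fastforce simp: homeomorphic_maps_def)
  then have contg: "continuous_on ?T (\<lambda>s. g (line_pt s))"
    by (simp add: o_def)
  show "homeomorphism U ?T (\<lambda>u. c u 0) (\<lambda>s. inv_into U c (line_pt s))"
  proof (rule homeomorphismI)
    show "continuous_on ?T (\<lambda>s. inv_into U c (line_pt s))"
      using contg by (rule continuous_on_eq) (simp add: inv)
    show "(\<lambda>u. c u 0) ` U \<subseteq> ?T" using line by auto
    show "(\<lambda>s. inv_into U c (line_pt s)) ` ?T \<subseteq> U" by (auto intro: inv_into_into)
    show "inv_into U c (line_pt (c u 0)) = u" if "u \<in> U" for u
      using that line[OF that] inj by (metis inv_into_f_f)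
    show "c (inv_into U c (line_pt s)) 0 = s" if "s \<in> ?T" for s
      using that f_inv_into_f[of "line_pt s" c U] by (simp add: line_pt_def)
  qed (fact cont)
qed

lemma chart_neighbourhood:
  assumes "analytic_manifold 1 (Half_space 1) A" "(U, c) \<in> A" "x \<in> U" "open N" "x \<in> N"
  obtains \<delta> where "\<delta> > 0" "\<And>u. u \<in> U \<Longrightarrow> \<bar>c u 0 - c x 0\<bar> < \<delta> \<Longrightarrow> u \<in> N"
proof -
  let ?T = "{s. line_pt s \<in> c ` U}"
  have h: "homeomorphism U ?T (\<lambda>u. c u 0) (\<lambda>s. inv_into U c (line_pt s))"
    using chart_homeomorphism assms by blast
  then have "continuous_on ?T (\<lambda>s. inv_into U c (line_pt s))" and T: "c x 0 \<in> ?T"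
    and inv: "\<And>u. u \<in> U \<Longrightarrow> inv_into U c (line_pt (c u 0)) = u" "\<And>u. u \<in> U \<Longrightarrow> c u 0 \<in> ?T"
    using assms(3) by (auto simp: homeomorphism_def)
  then have "((\<lambda>s. inv_into U c (line_pt s)) \<longlongrightarrow> x) (at (c x 0) within ?T)"
    using assms(3) by (fastforce simp: continuous_on_def)
  then have "\<forall>\<^sub>F s in at (c x 0) within ?T. inv_into U c (line_pt s) \<in> N"
    using assms(4,5) by (rule topological_tendstoD)
  then obtain d where "d > 0" "\<And>s. s \<in> ?T \<Longrightarrow> s \<noteq> c x 0 \<Longrightarrow> dist s (c x 0) < d \<Longrightarrow> inv_into U c (line_pt s) \<in> N"
    unfolding eventually_at by blast
  then show thesis
    using inv assms(3,5) by (intro that[of d]) (metis dist_real_def)+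
qed

text \<open>Uniqueness of one-sided derivatives and the identity theorem ask for accumulation in the
  coordinate, not on the curve.\<close>

lemma chart_islimpt:
  assumes A: "analytic_manifold 1 (Half_space 1) A" "(U, c) \<in> A" and x: "x \<in> U" "x islimpt X"
    and "X \<subseteq> U"
  shows "c x 0 islimpt (\<lambda>u. c u 0) ` X"
proof (rule islimptI)
  fix T assume T: "c x 0 \<in> T" "open T"
  have h: "continuous_on U (\<lambda>u. c u 0)" "open U" "inj_on c U" "\<And>u. u \<in> U \<Longrightarrow> c u = line_pt (c u 0)"
    using chart_homeomorphism[OF A] by (auto simp: homeomorphism_def)
  have "open (U \<inter> (\<lambda>u. c u 0) -` T)"
    using h(1,2) T(2) continuous_open_preimage by blast
  then obtain u where "u \<in> X" "u \<in> U" "c u 0 \<in> T" "u \<noteq> x"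
    using x T islimptE[OF x(2), of "U \<inter> (\<lambda>u. c u 0) -` T"] by blast
  then show "\<exists>y\<in>(\<lambda>u. c u 0) ` X. y \<in> T \<and> y \<noteq> c x 0"
    using h(3,4) x(1) by (metis imageI inj_onD)
qed

text \<open>A small step along the diagonal direction changes all \<open>n\<close> coordinates at
  once and stays in an open set. This supplies the corner points for
  \<open>analytic_compose_curve\<close> on \<open>M\<close>.\<close>

lemma euclidean_chart_corner:
  assumes "analytic_manifold n (Euclidean_space n) B" "(W, e) \<in> B" and x: "x \<in> W" "x \<in> N"
    and N: "open N" and r: "r > (0::real)"
  shows "\<exists>p\<in>e ` (W \<inter> N). \<forall>i<n. 0 < \<bar>p i - e x i\<bar> \<and> \<bar>p i - e x i\<bar> < r"
proof -
  let ?E = "Euclidean_space n"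
  have ch: "is_chart ?E (W, e)" using assms by (auto simp: analytic_manifold_def)
  then have hm: "homeomorphic_map (top_of_set W) (subtopology ?E (e ` W)) e" and W: "open W"
    and op: "openin ?E (e ` W)"
    by (auto simp: is_chart_def)
  have "openin (top_of_set W) (W \<inter> N)" using N by (simp add: openin_open_Int)
  then have "openin (subtopology ?E (e ` W)) (e ` (W \<inter> N))"
    using homeomorphic_imp_open_map[OF hm] by (simp add: open_map_def)
  then have opN: "openin ?E (e ` (W \<inter> N))" using op by (simp add: openin_open_subtopology)
  define p where "p = (\<lambda>t i. if i < n then e x i + t else (0::real))"
  have ex: "e x i = 0" if "i \<ge> n" for i
  proof -
    have "e x \<in> topspace ?E" using op x openin_subset by blast
    then show ?thesis using that by (simp add: topspace_Euclidean_space)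
  qed
  have p0: "p 0 = e x" by (auto simp: p_def fun_eq_iff ex)
  have "continuous_map euclideanreal ?E p"
    unfolding Euclidean_space_def continuous_map_in_subtopology continuous_map_componentwise_UNIV
  proof (intro conjI allI)
    fix k
    have "continuous_on UNIV (\<lambda>t. if k < n then e x k + t else (0::real))"
      by (cases "k < n") (auto intro!: continuous_intros)
    then show "continuous_map euclideanreal euclideanreal (\<lambda>t. p t k)"
      unfolding p_def by (simp only: continuous_map_iff_continuous2 subtopology_UNIV)
  qed (auto simp: p_def)
  then have "open {t. p t \<in> e ` (W \<inter> N)}"
    using openin_continuous_map_preimage[OF _ opN] by fastforce
  moreover have "0 \<in> {t. p t \<in> e ` (W \<inter> N)}" using p0 x by auto
  ultimately obtain \<delta> where \<delta>: "\<delta> > 0" "\<And>t. \<bar>t\<bar> < \<delta> \<Longrightarrow> p t \<in> e ` (W \<inter> N)"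
    unfolding open_dist by (auto simp: dist_real_def)
  define t where "t = min \<delta> r / 2"
  have t: "0 < t" "t < \<delta>" "t < r" using \<delta> r by (auto simp: t_def min_def)
  then show ?thesis using \<delta>(2)[of t] by (intro bexI[of _ "p t"]) (auto simp: p_def)
qed

lemma euclidean_chart_eq:
  assumes "analytic_manifold n (Euclidean_space n) B" "(W, e) \<in> B" "x \<in> W" "y \<in> W"
    and "\<And>i. i < n \<Longrightarrow> e x i = e y i"
  shows "x = y"
proof -
  let ?E = "Euclidean_space n"
  have ch: "is_chart ?E (W, e)" using assms by (auto simp: analytic_manifold_def)
  then have hm: "homeomorphic_map (top_of_set W) (subtopology ?E (e ` W)) e" and op: "openin ?E (e ` W)"
    by (auto simp: is_chart_def)
  have "e x \<in> topspace ?E" "e y \<in> topspace ?E" using op assms openin_subset by blast+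
  then have "e x = e y"
    using assms(5) by (auto simp: topspace_Euclidean_space fun_eq_iff) (metis not_le)
  then show ?thesis
    using homeomorphic_imp_injective_map[OF hm] assms by (auto dest: inj_onD)
qed

lemma analytic_map_onD:
  assumes "analytic_map_on n A m B Z f"
  shows "continuous_on Z f"
    and "(U, c) \<in> A \<Longrightarrow> (V, d) \<in> B \<Longrightarrow> j < m \<Longrightarrow>
      real_analytic_on n (c ` (U \<inter> Z \<inter> f -` V)) (\<lambda>t. d (f (inv_into U c t)) j)"
  using assms unfolding analytic_map_on_def by blast+

lemma islimpt_Int_open: "x islimpt S \<Longrightarrow> open N \<Longrightarrow> x \<in> N \<Longrightarrow> x islimpt S \<inter> N"
  by (simp add: islimpt_Int_eventually eventually_at_in_open')

text \<open>The instance of \<open>analytic_compose_curve\<close> with the identity as curve. A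
  corner point in dimension one is just another point nearby, so a limit point suffices and boundary
  points of the curve are included.\<close>

lemma curve_coordinate:
  assumes A: "analytic_manifold 1 (Half_space 1) A" "(U, c) \<in> A" and x: "x \<in> U" "x islimpt UNIV"
    and an: "analytic_map_on 1 A m B UNIV \<iota>" and W: "(W, e) \<in> B" "open W" "\<iota> x \<in> W" and j: "j < m"
  obtains F r where "r > 0" "F holomorphic_on ball (of_real (c x 0)) r"
    "\<And>u. u \<in> U \<Longrightarrow> \<iota> u \<in> W \<Longrightarrow> \<bar>c u 0 - c x 0\<bar> < r \<Longrightarrow> F (of_real (c u 0)) = of_real (e (\<iota> u) j)"
proof -
  let ?D = "c ` (U \<inter> UNIV \<inter> \<iota> -` W)"
  have h: "continuous_on U (\<lambda>u. c u 0)" "open U" "inj_on c U" "\<And>u. u \<in> U \<Longrightarrow> c u = line_pt (c u 0)"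
    using chart_homeomorphism[OF A] by (auto simp: homeomorphism_def)
  have ra: "real_analytic_on 1 ?D (\<lambda>t. e (\<iota> (inv_into U c t)) j)" and \<iota>: "continuous_on UNIV \<iota>"
    using analytic_map_onD[OF an] A(2) W(1) j by blast+
  have corner: "\<exists>p\<in>?D. \<forall>i<1. 0 < \<bar>p i - c x i\<bar> \<and> \<bar>p i - c x i\<bar> < r" if r: "r > 0" for r
  proof -
    have "open (U \<inter> \<iota> -` W)"
      using \<iota> h(2) W(2) by (simp add: open_Int open_vimage)
    then have "x islimpt (U \<inter> \<iota> -` W)"
      using x W(3) islimpt_Int_open[of x UNIV "U \<inter> \<iota> -` W"] by auto
    then have "c x 0 islimpt (\<lambda>u. c u 0) ` (U \<inter> \<iota> -` W)"
      using chart_islimpt[OF A x(1)] by blast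
    then obtain u where "u \<in> U \<inter> \<iota> -` W" "c u 0 \<noteq> c x 0" "\<bar>c u 0 - c x 0\<bar> < r"
      using r by (auto simp: islimpt_approachable dist_real_def)
    then show ?thesis by (intro bexI[of _ "c u"]) auto
  qed
  have "c x \<in> ?D" using x W by auto
  obtain F r where Fr: "0 < r" "F holomorphic_on ball (of_real (c x 0)) r"
    "\<And>s y. \<bar>s - c x 0\<bar> < r \<Longrightarrow> y \<in> ?D \<Longrightarrow> (\<And>i. i < 1 \<Longrightarrow> complex_of_real s = of_real (y i))
       \<Longrightarrow> F (of_real s) = of_real (e (\<iota> (inv_into U c y)) j)"
    by (rule analytic_compose_curve[OF ra \<open>c x \<in> ?D\<close> corner, of 1 "\<lambda>i w. w" "c x 0"])
       (simp_all add: holomorphic_on_id)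
  show thesis
  proof (rule that[OF Fr(1,2)])
    fix u assume "u \<in> U" "\<iota> u \<in> W" "\<bar>c u 0 - c x 0\<bar> < r"
    then show "F (of_real (c u 0)) = of_real (e (\<iota> u) j)"
      using Fr(3)[of "c u 0" "c u"] h(3) by auto
  qed
qed

text \<open>Analyticity of a composition, in the form needed later: the holomorphic coordinates of
  \<open>\<iota>\<close> in an intermediate chart \<open>e0\<close> are substituted into the power
  series of \<open>\<psi>\<close>.\<close>

lemma moved_curve_coordinate:
  assumes A: "analytic_manifold 1 (Half_space 1) A" "(U, c) \<in> A" and x: "x \<in> U" "x islimpt UNIV"
    and an: "analytic_map_on 1 A m B UNIV \<iota>" and B: "analytic_manifold m (Euclidean_space m) B"
    and \<psi>: "analytic_map_on m B m B UNIV \<psi>" and W: "(W, e) \<in> B" "open W" "\<psi> (\<iota> x) \<in> W" and j: "j < m"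
  obtains F r where "r > 0" "F holomorphic_on ball (of_real (c x 0)) r"
    "\<And>u. u \<in> U \<Longrightarrow> \<psi> (\<iota> u) \<in> W \<Longrightarrow> \<bar>c u 0 - c x 0\<bar> < r \<Longrightarrow> F (of_real (c u 0)) = of_real (e (\<psi> (\<iota> u)) j)"
proof -
  have "\<iota> x \<in> (\<Union>(U, c)\<in>B. U)" using B by (simp add: analytic_manifold_def)
  then obtain W0 e0 where W0: "(W0, e0) \<in> B" "\<iota> x \<in> W0" by blast
  then have "is_chart (Euclidean_space m) (W0, e0)" using B by (auto simp: analytic_manifold_def)
  then have W0': "open W0" and hm: "homeomorphic_map (top_of_set W0) (subtopology (Euclidean_space m) (e0 ` W0)) e0"
    by (auto simp: is_chart_def)
  have inj0: "inj_on e0 W0" using homeomorphic_imp_injective_map[OF hm] by simp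
  have "\<exists>F r. r > 0 \<and> F holomorphic_on ball (of_real (c x 0)) r \<and>
     (\<forall>u. u \<in> U \<longrightarrow> \<iota> u \<in> W0 \<longrightarrow> \<bar>c u 0 - c x 0\<bar> < r \<longrightarrow> F (of_real (c u 0)) = of_real (e0 (\<iota> u) i))"
    if "i < m" for i
    using curve_coordinate[OF A x an W0(1) W0' W0(2) that] by metis
  then obtain \<gamma> \<rho> where \<gamma>: "\<And>i. i < m \<Longrightarrow> \<rho> i > 0"
     "\<And>i. i < m \<Longrightarrow> \<gamma> i holomorphic_on ball (of_real (c x 0)) (\<rho> i)"
     "\<And>i u. i < m \<Longrightarrow> u \<in> U \<Longrightarrow> \<iota> u \<in> W0 \<Longrightarrow> \<bar>c u 0 - c x 0\<bar> < \<rho> i \<Longrightarrow> \<gamma> i (of_real (c u 0)) = of_real (e0 (\<iota> u) i)"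
    by metis
  \<comment> \<open>The inserted \<open>1\<close> keeps the set nonempty without a case distinction
    on \<open>m\<close>.\<close>
  define R where "R = Min (insert 1 (\<rho> ` {..<m}))"
  have R: "R > 0" and R_le: "\<And>i. i < m \<Longrightarrow> R \<le> \<rho> i" using \<gamma>(1) by (auto simp: R_def)
  let ?D = "e0 ` (W0 \<inter> UNIV \<inter> \<psi> -` W)"
  have ra: "real_analytic_on m ?D (\<lambda>t. e (\<psi> (inv_into W0 e0 t)) j)" and \<psi>c: "continuous_on UNIV \<psi>"
    using analytic_map_onD[OF \<psi>] W0(1) W(1) j by blast+
  have "open (\<psi> -` W)" using \<psi>c W(2) by (simp add: open_vimage)
  then have corner: "\<exists>p\<in>?D. \<forall>i<m. 0 < \<bar>p i - e0 (\<iota> x) i\<bar> \<and> \<bar>p i - e0 (\<iota> x) i\<bar> < r" if "r > 0" for r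
    using euclidean_chart_corner[OF B W0(1,2) _ _ that, of "\<psi> -` W"] W(3) by auto
  have xD: "e0 (\<iota> x) \<in> ?D" using W0 W by auto
  obtain F r where Fr: "0 < r" "r \<le> R" "F holomorphic_on ball (of_real (c x 0)) r"
    "\<And>s y. \<bar>s - c x 0\<bar> < r \<Longrightarrow> y \<in> ?D \<Longrightarrow> (\<And>i. i < m \<Longrightarrow> \<gamma> i (of_real s) = of_real (y i))
       \<Longrightarrow> F (of_real s) = of_real (e (\<psi> (inv_into W0 e0 y)) j)"
  proof (rule analytic_compose_curve[OF ra xD corner R, of \<gamma> "c x 0"])
    show "\<gamma> i holomorphic_on ball (of_real (c x 0)) R" if "i < m" for i
      using \<gamma>(2)[OF that] by (rule holomorphic_on_subset) (use R_le[OF that] in auto)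
    show "\<gamma> i (of_real (c x 0)) = of_real (e0 (\<iota> x) i)" if "i < m" for i
      using \<gamma>(3)[OF that x(1) W0(2)] \<gamma>(1)[OF that] by simp
  qed blast+
  have "continuous_on UNIV \<iota>" using an by (simp add: analytic_map_on_def)
  then have "open (\<iota> -` W0)" using W0' by (simp add: open_vimage)
  \<comment> \<open>The expansions of \<open>\<iota>\<close> are valid only where
    \<open>\<iota> u\<close> lies in \<open>W0\<close>, while the claim assumes just that
    \<open>\<psi> (\<iota> u)\<close> lies in \<open>W\<close>; \<open>\<delta>\<close> closes this
    gap.\<close>
  then obtain \<delta> where \<delta>: "\<delta> > 0" "\<And>u. u \<in> U \<Longrightarrow> \<bar>c u 0 - c x 0\<bar> < \<delta> \<Longrightarrow> u \<in> \<iota> -` W0"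
    using chart_neighbourhood[OF A x(1), of "\<iota> -` W0"] W0(2) by blast
  show thesis
  proof (rule that[of "min r \<delta>" F])
    show "min r \<delta> > 0" using Fr \<delta> by simp
    show "F holomorphic_on ball (of_real (c x 0)) (min r \<delta>)"
      using Fr(3) by (rule holomorphic_on_subset) auto
    fix u assume u: "u \<in> U" "\<psi> (\<iota> u) \<in> W" "\<bar>c u 0 - c x 0\<bar> < min r \<delta>"
    then have "\<iota> u \<in> W0" using \<delta> by auto
    then show "F (of_real (c u 0)) = of_real (e (\<psi> (\<iota> u)) j)"
    proof -
      have "\<gamma> i (of_real (c u 0)) = of_real (e0 (\<iota> u) i)" if "i < m" for i
        using \<gamma>(3)[OF that u(1) \<open>\<iota> u \<in> W0\<close>] u(3) Fr(2) R_le[OF that] by simp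
      then show ?thesis
        using Fr(4)[of "c u 0" "e0 (\<iota> u)"] u inj0 \<open>\<iota> u \<in> W0\<close> by simp
    qed
  qed
qed

section \<open>Local reparametrisations of analytic curves\<close>

text \<open>Links the one-sided real derivative in \<open>immersive_on\<close> to the complex
  derivative of an extension, so that a nonzero real derivative yields local invertibility.\<close>

lemma holomorphic_restrict_real_derivative:
  assumes hol: "F holomorphic_on ball (of_real t0) r" "r > 0"
    and eq: "\<And>s. s \<in> T \<Longrightarrow> \<bar>s - t0\<bar> < r \<Longrightarrow> F (of_real s) = of_real (f s)"
    and t0: "t0 \<in> T"
  shows "(f has_real_derivative Re (deriv F (of_real t0))) (at t0 within T)"
proof -
  have "(F has_field_derivative deriv F (of_real t0)) (at (of_real t0))"
    using hol by (intro holomorphic_derivI[of _ "ball (of_real t0) r"]) auto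
  then have "((\<lambda>s. F (of_real s)) has_vector_derivative deriv F (of_real t0)) (at t0 within T)"
    by (rule has_vector_derivative_real_field)
  then have "((\<lambda>s. Re (F (of_real s))) has_vector_derivative Re (deriv F (of_real t0))) (at t0 within T)"
    by (rule bounded_linear.has_vector_derivative[OF bounded_linear_Re])
  then have "((\<lambda>s. Re (F (of_real s))) has_real_derivative Re (deriv F (of_real t0))) (at t0 within T)"
    by (simp add: has_real_derivative_iff_has_vector_derivative)
  then show ?thesis
    by (rule has_field_derivative_transform_within[OF _ hol(2) t0]) (simp add: eq dist_real_def)
qed

text \<open>
  In charts, \<open>F\<close> is the local inverse of an immersed coordinate of \<open>\<iota>\<close>, applied to the same coordinate of \<open>\<psi> \<circ> \<iota>\<close>.
  The remaining coordinates are controlled by the identity theorem once \<open>x\<close> is a limit of points that lift.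
\<close>

lemma local_lift:
  assumes A: "analytic_manifold 1 (Half_space 1) A" and B: "analytic_manifold m (Euclidean_space m) B"
    and an: "analytic_map_on 1 A m B UNIV \<iota>" and imm: "immersive_on A m B UNIV \<iota>"
    and \<psi>: "analytic_map_on m B m B UNIV \<psi>"
    and U: "(U, c) \<in> A" "x \<in> U" "x islimpt UNIV" and V: "(V, d) \<in> A" "y \<in> V" "y islimpt UNIV"
    and xy: "\<psi> (\<iota> x) = \<iota> y"
  obtains F r M N where "r > 0" "F holomorphic_on ball (of_real (c x 0)) r" "F (of_real (c x 0)) = of_real (d y 0)"
    "open M" "x \<in> M" "open N" "y \<in> N" "N \<subseteq> V"
    "\<And>u v. u \<in> U \<Longrightarrow> v \<in> N \<Longrightarrow> \<bar>c u 0 - c x 0\<bar> < r \<Longrightarrow> \<psi> (\<iota> u) = \<iota> v \<Longrightarrow> F (of_real (c u 0)) = of_real (d v 0)"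
    "\<And>u v. x islimpt {u \<in> U. \<exists>v\<in>N. \<psi> (\<iota> u) = \<iota> v} \<Longrightarrow> u \<in> U \<inter> M \<Longrightarrow> v \<in> N \<Longrightarrow> \<bar>c u 0 - c x 0\<bar> < r \<Longrightarrow>
       F (of_real (c u 0)) = of_real (d v 0) \<Longrightarrow> \<psi> (\<iota> u) = \<iota> v"
    "\<And>s. x islimpt {u \<in> U. \<exists>v\<in>N. \<psi> (\<iota> u) = \<iota> v} \<Longrightarrow> \<bar>s - c x 0\<bar> < r \<Longrightarrow> Im (F (of_real s)) = 0"
proof -
  obtain W e where W: "(W, e) \<in> B" "\<iota> y \<in> W" 
  proof -
    have "\<iota> y \<in> (\<Union>(U, c)\<in>B. U)" using B by (simp add: analytic_manifold_def)
    then show thesis using that by blast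
  qed
  then have "is_chart (Euclidean_space m) (W, e)" using B by (auto simp: analytic_manifold_def)
  then have W': "open W" by (simp add: is_chart_def)
  have \<psi>W: "\<psi> (\<iota> x) \<in> W" using W xy by simp
  have "\<exists>F r. r > 0 \<and> F holomorphic_on ball (of_real (c x 0)) r \<and>
     (\<forall>u. u \<in> U \<longrightarrow> \<psi> (\<iota> u) \<in> W \<longrightarrow> \<bar>c u 0 - c x 0\<bar> < r \<longrightarrow> F (of_real (c u 0)) = of_real (e (\<psi> (\<iota> u)) i))"
    if "i < m" for i
    using moved_curve_coordinate[OF A U an B \<psi> W(1) W' \<psi>W that] by metis
  then obtain \<Gamma>1 \<rho>1 where \<Gamma>1: "\<And>i. i < m \<Longrightarrow> \<rho>1 i > 0"
     "\<And>i. i < m \<Longrightarrow> \<Gamma>1 i holomorphic_on ball (of_real (c x 0)) (\<rho>1 i)"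
     "\<And>i u. i < m \<Longrightarrow> u \<in> U \<Longrightarrow> \<psi> (\<iota> u) \<in> W \<Longrightarrow> \<bar>c u 0 - c x 0\<bar> < \<rho>1 i \<Longrightarrow>
        \<Gamma>1 i (of_real (c u 0)) = of_real (e (\<psi> (\<iota> u)) i)"
    by metis
  have "\<exists>F r. r > 0 \<and> F holomorphic_on ball (of_real (d y 0)) r \<and>
     (\<forall>u. u \<in> V \<longrightarrow> \<iota> u \<in> W \<longrightarrow> \<bar>d u 0 - d y 0\<bar> < r \<longrightarrow> F (of_real (d u 0)) = of_real (e (\<iota> u) i))"
    if "i < m" for i
    using curve_coordinate[OF A V an W(1) W' W(2) that] by metis
  then obtain \<Gamma>2 \<rho>2 where \<Gamma>2: "\<And>i. i < m \<Longrightarrow> \<rho>2 i > 0"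
     "\<And>i. i < m \<Longrightarrow> \<Gamma>2 i holomorphic_on ball (of_real (d y 0)) (\<rho>2 i)"
     "\<And>i v. i < m \<Longrightarrow> v \<in> V \<Longrightarrow> \<iota> v \<in> W \<Longrightarrow> \<bar>d v 0 - d y 0\<bar> < \<rho>2 i \<Longrightarrow>
        \<Gamma>2 i (of_real (d v 0)) = of_real (e (\<iota> v) i)"
    by metis
  define R1 where "R1 = Min (insert 1 (\<rho>1 ` {..<m}))"
  have R1: "R1 > 0" and R1_le: "\<And>i. i < m \<Longrightarrow> R1 \<le> \<rho>1 i" using \<Gamma>1(1) by (auto simp: R1_def)
  define R2 where "R2 = Min (insert 1 (\<rho>2 ` {..<m}))"
  have R2: "R2 > 0" and R2_le: "\<And>i. i < m \<Longrightarrow> R2 \<le> \<rho>2 i" using \<Gamma>2(1) by (auto simp: R2_def)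
  have \<Gamma>1h: "\<Gamma>1 i holomorphic_on ball (of_real (c x 0)) R1" if "i < m" for i
    using \<Gamma>1(2)[OF that] by (rule holomorphic_on_subset) (use R1_le[OF that] in auto)
  have \<Gamma>2h: "\<Gamma>2 i holomorphic_on ball (of_real (d y 0)) R2" if "i < m" for i
    using \<Gamma>2(2)[OF that] by (rule holomorphic_on_subset) (use R2_le[OF that] in auto)
  have \<iota>c: "continuous_on UNIV \<iota>" using analytic_map_onD(1)[OF an] .
  have \<psi>c: "continuous_on UNIV \<psi>" using analytic_map_onD(1)[OF \<psi>] .
  have op\<iota>: "open (\<iota> -` W)" using \<iota>c W' by (simp add: open_vimage)
  have op\<psi>: "open ((\<lambda>u. \<psi> (\<iota> u)) -` W)"
    using continuous_on_compose2[OF \<psi>c \<iota>c] W' by (simp add: open_vimage)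

  \<comment> \<open>Immersivity gives a nonzero derivative within \<open>?T\<close>. It must be the
    real part of the complex derivative, because derivatives are unique at a limit point of
    \<open>?T\<close>; hence the complex derivative is nonzero too.\<close>
  obtain j where j: "j < m" and dj: "deriv (\<Gamma>2 j) (of_real (d y 0)) \<noteq> 0"
  proof -
    let ?T = "{s. line_pt s \<in> d ` (V \<inter> UNIV \<inter> \<iota> -` W)}"
    obtain j D where jD: "j < m" "D \<noteq> 0"
      and der: "((\<lambda>s. e (\<iota> (inv_into V d (line_pt s))) j) has_real_derivative D) (at (d y 0) within ?T)"
      using imm V(1,2) W unfolding immersive_on_def by blast
    note ch = chart_homeomorphism[OF A V(1)]
    have yT: "d y 0 \<in> ?T" using ch(4)[OF V(2)] V(2) W(2) by auto
    have "((\<lambda>s. e (\<iota> (inv_into V d (line_pt s))) j) has_real_derivative Re (deriv (\<Gamma>2 j) (of_real (d y 0))))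
        (at (d y 0) within ?T)"
    proof (rule holomorphic_restrict_real_derivative[OF \<Gamma>2h[OF jD(1)] R2 _ yT])
      fix s assume s: "s \<in> ?T" "\<bar>s - d y 0\<bar> < R2"
      then obtain v where v: "v \<in> V" "\<iota> v \<in> W" "line_pt s = d v" by auto
      then have "inv_into V d (line_pt s) = v" using ch(3) by simp
      moreover have "d v 0 = s" using v(3) by (metis line_pt_def)
      ultimately show "\<Gamma>2 j (of_real s) = of_real (e (\<iota> (inv_into V d (line_pt s))) j)"
        using \<Gamma>2(3)[OF jD(1) v(1,2)] s(2) R2_le[OF jD(1)] by auto
    qed
    moreover have "at (d y 0) within ?T \<noteq> bot"
    proof -
      have "open (V \<inter> \<iota> -` W)" using op\<iota> ch(2) by auto
      then have "y islimpt (V \<inter> \<iota> -` W)" using islimpt_Int_open[OF V(3), of "V \<inter> \<iota> -` W"] V W by auto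
      then have "d y 0 islimpt (\<lambda>u. d u 0) ` (V \<inter> \<iota> -` W)"
        using chart_islimpt[OF A V(1,2)] by blast
      moreover have "(\<lambda>u. d u 0) ` (V \<inter> \<iota> -` W) \<subseteq> ?T" using ch(4) by fastforce
      ultimately have "d y 0 islimpt ?T" using islimpt_subset by blast
      then show ?thesis by (simp add: trivial_limit_within)
    qed
    ultimately have "D = Re (deriv (\<Gamma>2 j) (of_real (d y 0)))"
      using der has_field_derivative_unique by blast
    then show thesis using that jD by force
  qed

  obtain r2 where r2: "r2 > 0" "ball (complex_of_real (d y 0)) r2 \<subseteq> ball (of_real (d y 0)) R2"
    "open (\<Gamma>2 j ` ball (of_real (d y 0)) r2)" "inj_on (\<Gamma>2 j) (ball (of_real (d y 0)) r2)"
    using has_complex_derivative_locally_invertible[OF \<Gamma>2h[OF j] _ _ dj] R2 by auto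
  define Y where "Y = ball (complex_of_real (d y 0)) r2"
  have Yh: "\<Gamma>2 i holomorphic_on Y" if "i < m" for i
    using \<Gamma>2h[OF that] r2(2) holomorphic_on_subset unfolding Y_def by blast
  obtain P where P: "P holomorphic_on (\<Gamma>2 j ` Y)" "\<And>w. w \<in> Y \<Longrightarrow> P (\<Gamma>2 j w) = w"
    using holomorphic_has_inverse[OF Yh[OF j] _ r2(4)[folded Y_def]] open_ball unfolding Y_def by metis
  let ?X = "\<lambda>r. ball (complex_of_real (c x 0)) r"
  have \<Gamma>1x: "\<Gamma>1 i (of_real (c x 0)) = of_real (e (\<iota> y) i)" if "i < m" for i
    using \<Gamma>1(3)[OF that U(2) \<psi>W] \<Gamma>1(1)[OF that] xy by simp
  have \<Gamma>2y: "\<Gamma>2 i (of_real (d y 0)) = of_real (e (\<iota> y) i)" if "i < m" for i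
    using \<Gamma>2(3)[OF that V(2) W(2)] \<Gamma>2(1)[OF that] by simp
  \<comment> \<open>At the two centres \<open>\<Gamma>1 j\<close> and \<open>\<Gamma>2 j\<close>
    have the same value, so a small disc is sent by \<open>\<Gamma>1 j\<close> into the range of
    \<open>\<Gamma>2 j\<close>, where the inverse \<open>P\<close> is defined.\<close>
  have "open (?X R1 \<inter> \<Gamma>1 j -` (\<Gamma>2 j ` Y))"
    using \<Gamma>1h[OF j] r2(3) holomorphic_on_imp_continuous_on continuous_open_preimage unfolding Y_def by blast
  moreover have "of_real (c x 0) \<in> ?X R1 \<inter> \<Gamma>1 j -` (\<Gamma>2 j ` Y)"
    using R1 r2(1) \<Gamma>1x[OF j] \<Gamma>2y[OF j] unfolding Y_def by (auto intro!: image_eqI[of _ _ "of_real (d y 0)"])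
  ultimately obtain r where r: "r > 0" "?X r \<subseteq> ?X R1 \<inter> \<Gamma>1 j -` (\<Gamma>2 j ` Y)"
    by (meson open_contains_ball)
  then have rR1: "?X r \<subseteq> ?X R1" and r\<Gamma>: "\<Gamma>1 j ` ?X r \<subseteq> \<Gamma>2 j ` Y" by auto
  define F where "F = (\<lambda>w. P (\<Gamma>1 j w))"
  have Fh: "F holomorphic_on ?X r"
    unfolding F_def using holomorphic_on_compose_gen[OF holomorphic_on_subset[OF \<Gamma>1h[OF j] rR1] P(1) r\<Gamma>]
    by (simp add: o_def)
  have FY: "F w \<in> Y" if "w \<in> ?X r" for w
    using r\<Gamma> P(2) that by (force simp: F_def)
  have inX: "of_real s \<in> ?X r \<longleftrightarrow> \<bar>s - c x 0\<bar> < r" for s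
    by (simp add: dist_norm abs_minus_commute flip: of_real_diff)
  have inY: "of_real s \<in> Y \<longleftrightarrow> \<bar>s - d y 0\<bar> < r2" for s
    unfolding Y_def by (simp add: dist_norm abs_minus_commute flip: of_real_diff)
  have smallX: "\<bar>s - c x 0\<bar> < \<rho>1 i" if "\<bar>s - c x 0\<bar> < r" "i < m" for s i
  proof -
    have "complex_of_real s \<in> ?X R1" using rR1 that inX by blast
    then have "\<bar>s - c x 0\<bar> < R1" by (simp add: dist_norm abs_minus_commute flip: of_real_diff)
    then show ?thesis using R1_le[OF that(2)] by simp
  qed
  have smallY: "\<bar>s - d y 0\<bar> < \<rho>2 i" if "\<bar>s - d y 0\<bar> < r2" "i < m" for s i
  proof -
    have "complex_of_real s \<in> ball (of_real (d y 0)) R2" using r2(2) that inY unfolding Y_def by blast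
    then have "\<bar>s - d y 0\<bar> < R2" by (simp add: dist_norm abs_minus_commute flip: of_real_diff)
    then show ?thesis using R2_le[OF that(2)] by simp
  qed
  \<comment> \<open>\<open>P\<close> undoes \<open>\<Gamma>2 j\<close> only on \<open>Y\<close>, so
    \<open>N\<close> bounds the coordinate and not merely the image point: the curve may return near
    \<open>\<iota> y\<close> with distant parameters.\<close>
  define N where "N = (V \<inter> (\<lambda>v. d v 0) -` {s. \<bar>s - d y 0\<bar> < r2}) \<inter> \<iota> -` W"
  note chV = chart_homeomorphism[OF A V(1)]
  have "open {s. \<bar>s - d y 0\<bar> < r2}"
    by (intro open_Collect_less continuous_intros)
  moreover have "continuous_on V (\<lambda>v. d v 0)" using chV(1) by (simp add: homeomorphism_def)
  ultimately have N: "open N"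
    unfolding N_def using chV(2) op\<iota> continuous_open_preimage open_Int by blast
  have NY: "of_real (d v 0) \<in> Y" if "v \<in> N" for v using that inY by (simp add: N_def)
  have lift: "F (of_real (c u 0)) = of_real (d v 0)"
    if "u \<in> U" "v \<in> N" "\<bar>c u 0 - c x 0\<bar> < r" "\<psi> (\<iota> u) = \<iota> v" for u v
  proof -
    have v: "v \<in> V" "\<iota> v \<in> W" "\<bar>d v 0 - d y 0\<bar> < r2" using that by (auto simp: N_def)
    have "\<Gamma>1 j (of_real (c u 0)) = of_real (e (\<iota> v) j)"
      using \<Gamma>1(3)[OF j that(1) _ smallX[OF that(3) j]] that(4) v(2) by simp
    also have "\<dots> = \<Gamma>2 j (of_real (d v 0))"
      using \<Gamma>2(3)[OF j v(1,2) smallY[OF v(3) j]] by simp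
    finally show ?thesis using P(2)[OF NY[OF that(2)]] by (simp add: F_def)
  qed
  let ?L = "{u \<in> U. \<exists>v\<in>N. \<psi> (\<iota> u) = \<iota> v}"
  \<comment> \<open>Complex coordinates of the points that lift; the identity theorem is applied to
    this set, which accumulates at the centre whenever \<open>x\<close> is a limit of such
    points.\<close>
  let ?LX = "{w :: complex. \<exists>u\<in>?L. w = of_real (c u 0) \<and> \<bar>c u 0 - c x 0\<bar> < r}"
  have LX: "complex_of_real (c x 0) islimpt ?LX" if lim: "x islimpt ?L"
  proof -
    have "c x 0 islimpt (\<lambda>u. c u 0) ` ?L"
      using chart_islimpt[OF A U(1,2) lim] by blast
    then show ?thesis
      unfolding islimpt_approachable
    proof (intro allI impI)
      fix \<epsilon> :: real assume "\<epsilon> > 0" 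
      then have "min \<epsilon> r > 0" using r by simp
      then obtain u where u: "u \<in> ?L" "c u 0 \<noteq> c x 0" "dist (c u 0) (c x 0) < min \<epsilon> r"
        using \<open>c x 0 islimpt (\<lambda>u. c u 0) ` ?L\<close> unfolding islimpt_approachable by blast
      then show "\<exists>x'\<in>?LX. x' \<noteq> of_real (c x 0) \<and> dist x' (of_real (c x 0)) < \<epsilon>"
        by (intro bexI[of _ "of_real (c u 0)"]) (auto simp: dist_norm simp flip: of_real_diff)
    qed
  qed
  have LXsub: "?LX \<subseteq> ?X r" using inX by auto
  \<comment> \<open>Only the coordinate \<open>j\<close> agrees by construction of \<open>F\<close>.
    For the others, a point that lifts has an actual partner \<open>v\<close>, whose coordinate is
    the value of \<open>F\<close>, so the difference vanishes on \<open>?LX\<close>.\<close>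
  have agree: "\<Gamma>1 i w = \<Gamma>2 i (F w)" if lim: "x islimpt ?L" and i: "i < m" and w: "w \<in> ?X r" for i w
  proof -
    have h: "(\<lambda>w. \<Gamma>1 i w - \<Gamma>2 i (F w)) holomorphic_on ?X r"
      using holomorphic_on_compose_gen[OF Fh Yh[OF i] image_subsetI[OF FY]]
      by (intro holomorphic_intros holomorphic_on_subset[OF \<Gamma>1h[OF i] rR1]) (auto simp: o_def)
    have z: "\<Gamma>1 i w - \<Gamma>2 i (F w) = 0" if "w \<in> ?LX" for w
    proof -
      obtain u v where u: "u \<in> U" "v \<in> N" "\<psi> (\<iota> u) = \<iota> v" "w = of_real (c u 0)" "\<bar>c u 0 - c x 0\<bar> < r"
        using \<open>w \<in> ?LX\<close> by blast
      have v: "v \<in> V" "\<iota> v \<in> W" "\<bar>d v 0 - d y 0\<bar> < r2" using u by (auto simp: N_def)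
      show ?thesis
        using lift[OF u(1,2,5,3)] \<Gamma>1(3)[OF i u(1) _ smallX[OF u(5) i]] \<Gamma>2(3)[OF i v(1,2) smallY[OF v(3) i]] u v by simp
    qed
    have "\<Gamma>1 i w - \<Gamma>2 i (F w) = 0"
      by (rule analytic_continuation[OF h _ _ LXsub _ LX[OF lim] z w]) (use r in auto)
    then show ?thesis by simp
  qed
  have realF: "Im (F (of_real s)) = 0" if lim: "x islimpt ?L" and s: "\<bar>s - c x 0\<bar> < r" for s
  proof -
    \<comment> \<open>\<open>F\<close> agrees with its Schwarz reflection at the points that lift, hence everywhere.\<close>
    have "cnj ` ?X r = ?X r"
    proof -
      have "cnj w \<in> ?X r" if "w \<in> ?X r" for w
        using that by (metis complex_cnj_complex_of_real complex_cnj_diff complex_mod_cnj dist_norm mem_ball)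
      then show ?thesis by (metis (no_types, lifting) complex_cnj_cnj image_eqI image_subsetI subsetI subset_antisym)
    qed
    then have "cnj \<circ> F \<circ> cnj holomorphic_on ?X r"
      using holomorphic_on_compose_cnj_cnj[of F "?X r"] Fh by simp
    then have h: "(\<lambda>w. cnj (F (cnj w)) - F w) holomorphic_on ?X r"
      using Fh by (intro holomorphic_intros) (auto simp: o_def)
    have z: "cnj (F (cnj w)) - F w = 0" if "w \<in> ?LX" for w
    proof -
      obtain u v where u: "u \<in> U" "v \<in> N" "\<psi> (\<iota> u) = \<iota> v" "w = of_real (c u 0)" "\<bar>c u 0 - c x 0\<bar> < r"
        using \<open>w \<in> ?LX\<close> by blast
      show ?thesis using lift[OF u(1,2,5,3)] u(4) by simp
    qed
    have "cnj (F (cnj (of_real s))) - F (of_real s) = 0"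
      by (rule analytic_continuation[OF h _ _ LXsub _ LX[OF lim] z]) (use r s inX in auto)
    then show ?thesis by (metis complex_cnj_complex_of_real eq_iff_diff_eq_0 Reals_cnj_iff complex_is_Real_iff)
  qed
  show thesis
  proof (rule that[OF r(1) Fh _ op\<psi> _ N _ _ lift])
    show "F (of_real (c x 0)) = of_real (d y 0)"
      using P(2)[of "of_real (d y 0)"] r2(1) \<Gamma>1x[OF j] \<Gamma>2y[OF j] by (simp add: F_def Y_def)
    show "x \<in> (\<lambda>u. \<psi> (\<iota> u)) -` W" using \<psi>W by simp
    show "y \<in> N" using V W r2(1) by (simp add: N_def)
    show "N \<subseteq> V" by (auto simp: N_def)
    show "\<psi> (\<iota> u) = \<iota> v" if lim: "x islimpt ?L" and u: "u \<in> U \<inter> (\<lambda>u. \<psi> (\<iota> u)) -` W" and v: "v \<in> N"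
      and s: "\<bar>c u 0 - c x 0\<bar> < r" and eq: "F (of_real (c u 0)) = of_real (d v 0)" for u v
    proof (rule euclidean_chart_eq[OF B W(1)])
      have v': "v \<in> V" "\<iota> v \<in> W" "\<bar>d v 0 - d y 0\<bar> < r2" using v by (auto simp: N_def)
      then show "\<iota> v \<in> W" by simp
      show "\<psi> (\<iota> u) \<in> W" using u by simp
      fix i assume i: "i < m"
      have "complex_of_real (e (\<psi> (\<iota> u)) i) = \<Gamma>1 i (of_real (c u 0))"
        using \<Gamma>1(3)[OF i _ _ smallX[OF s i]] u by simp
      also have "\<dots> = \<Gamma>2 i (of_real (d v 0))" using agree[OF lim i] inX s eq by simp
      also have "\<dots> = of_real (e (\<iota> v) i)" using \<Gamma>2(3)[OF i v'(1,2) smallY[OF v'(3) i]] by simp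
      finally show "e (\<psi> (\<iota> u)) i = e (\<iota> v) i" by simp
    qed
    show "Im (F (of_real s)) = 0" if "x islimpt ?L" "\<bar>s - c x 0\<bar> < r" for s
      using realF that by blast
  qed
qed

text \<open>An isolated point \<open>x\<close> would be separated from the rest of \<open>S\<close>
  by its neighbourhood \<open>T\<close> and the complement of \<open>{x}\<close>, which is open in a
  T1 space.\<close>

lemma islimpt_connected:
  fixes x :: "'a::t1_space"
  assumes "connected S" "x \<in> S" "y \<in> S" "z \<in> S" "y \<noteq> z"
  shows "x islimpt S"
proof (rule ccontr)
  assume "\<not> x islimpt S"
  then obtain T where T: "x \<in> T" "open T" "\<forall>y\<in>S. y \<in> T \<longrightarrow> y = x"
    unfolding islimpt_def by blast
  have "T \<inter> S = {} \<or> - {x} \<inter> S = {}"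
    by (rule connectedD[OF assms(1) T(2)]) (use T in auto)
  moreover have "\<exists>w\<in>S. w \<noteq> x" using assms(3-5) by metis
  ultimately show False using T(1) assms(2) by blast
qed

section \<open>Continuous lifts are analytic diffeomorphisms\<close>

locale analytic_curve =
  fixes m :: nat and B :: "'m::t2_space chart set"
    and A :: "'s::{t2_space, second_countable_topology} chart set" and \<iota> :: "'s \<Rightarrow> 'm"
  assumes B: "analytic_manifold m (Euclidean_space m) B"
    and A: "analytic_manifold 1 (Half_space 1) A"
    and \<iota>_analytic: "analytic_map_on 1 A m B UNIV \<iota>"
    and \<iota>_immersive: "immersive_on A m B UNIV \<iota>"
    and islimpt_UNIV: "x islimpt (UNIV :: 's set)"
begin

text \<open>\<open>local_lift\<close> only controls partners in \<open>N\<close>. Continuity of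
  \<open>f\<close> forces \<open>f u\<close> into \<open>N\<close> for \<open>u\<close> near
  \<open>x\<close>, which is the purpose of \<open>Q\<close> and \<open>\<delta>\<close>.\<close>

lemma lift_extends_holomorphically:
  assumes \<psi>: "analytic_map_on m B m B UNIV \<psi>"
    and f: "continuous_on \<Sigma> f" "\<And>x. x \<in> \<Sigma> \<Longrightarrow> \<psi> (\<iota> x) = \<iota> (f x)"
    and UV: "(U, c) \<in> A" "(V, d) \<in> A" and x: "x \<in> U \<inter> \<Sigma> \<inter> f -` V"
  obtains F r where "r > 0" "F holomorphic_on ball (of_real (c x 0)) r"
    "\<And>u. u \<in> U \<inter> \<Sigma> \<inter> f -` V \<Longrightarrow> \<bar>c u 0 - c x 0\<bar> < r \<Longrightarrow> F (of_real (c u 0)) = of_real (d (f u) 0)"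
proof -
  have xs: "x \<in> U" "x \<in> \<Sigma>" "f x \<in> V" using x by auto
  obtain F r N where Fr: "r > 0" "F holomorphic_on ball (of_real (c x 0)) r"
    and N: "open N" "f x \<in> N"
    and lift: "\<And>u v. u \<in> U \<Longrightarrow> v \<in> N \<Longrightarrow> \<bar>c u 0 - c x 0\<bar> < r \<Longrightarrow> \<psi> (\<iota> u) = \<iota> v \<Longrightarrow> F (of_real (c u 0)) = of_real (d v 0)"
    by (rule local_lift[OF A B \<iota>_analytic \<iota>_immersive \<psi> UV(1) xs(1) islimpt_UNIV UV(2) xs(3) islimpt_UNIV f(2)[OF xs(2)]]) blast
  obtain Q where Q: "open Q" "Q \<inter> \<Sigma> = f -` N \<inter> \<Sigma>"
    using f(1) N(1) unfolding continuous_on_open_invariant by blast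
  then have "x \<in> Q" using xs N by blast
  then obtain \<delta> where \<delta>: "\<delta> > 0" "\<And>u. u \<in> U \<Longrightarrow> \<bar>c u 0 - c x 0\<bar> < \<delta> \<Longrightarrow> u \<in> Q"
    using chart_neighbourhood[OF A UV(1) xs(1) Q(1)] by blast
  show thesis
  proof (rule that[of "min r \<delta>" F])
    show "F holomorphic_on ball (of_real (c x 0)) (min r \<delta>)"
      using Fr(2) by (rule holomorphic_on_subset) auto
    show "F (of_real (c u 0)) = of_real (d (f u) 0)"
      if "u \<in> U \<inter> \<Sigma> \<inter> f -` V" "\<bar>c u 0 - c x 0\<bar> < min r \<delta>" for u
    proof (rule lift)
      show "f u \<in> N" using \<delta>(2)[of u] Q(2) that by auto
    qed (use that f(2) in auto)
  qed (use Fr \<delta> in auto)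
qed

text \<open>Near each point the lift is, in charts, the restriction of a holomorphic function on a
  full disc. End points of \<open>\<Sigma>\<close> therefore need no separate treatment.\<close>

lemma lift_analytic:
  assumes \<psi>: "analytic_map_on m B m B UNIV \<psi>"
    and f: "continuous_on \<Sigma> f" "\<And>x. x \<in> \<Sigma> \<Longrightarrow> \<psi> (\<iota> x) = \<iota> (f x)"
  shows "analytic_map_on 1 A 1 A \<Sigma> f"
proof -
  have "real_analytic_on 1 (c ` (U \<inter> \<Sigma> \<inter> f -` V)) (\<lambda>t. d (f (inv_into U c t)) 0)"
    if UV: "(U, c) \<in> A" "(V, d) \<in> A" for U c V d
  proof (rule real_analytic_on_1I)
  note inj = chart_homeomorphism(3)[OF A UV(1)]
    fix t assume "t \<in> c ` (U \<inter> \<Sigma> \<inter> f -` V)"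
    then obtain x where x: "x \<in> U \<inter> \<Sigma> \<inter> f -` V" "t = c x" by blast
    obtain F r where Fr: "r > 0" "F holomorphic_on ball (of_real (c x 0)) r"
      "\<And>u. u \<in> U \<inter> \<Sigma> \<inter> f -` V \<Longrightarrow> \<bar>c u 0 - c x 0\<bar> < r \<Longrightarrow> F (of_real (c u 0)) = of_real (d (f u) 0)"
      by (rule lift_extends_holomorphically[OF \<psi> f UV x(1)]) blast+
    then show "\<exists>F r. 0 < r \<and> F holomorphic_on ball (of_real (t 0)) r \<and>
     (\<forall>y\<in>c ` (U \<inter> \<Sigma> \<inter> f -` V). \<bar>y 0 - t 0\<bar> < r \<longrightarrow> F (of_real (y 0)) = of_real (d (f (inv_into U c y)) 0))"
      using x(2) inj by (intro exI[of _ F] exI[of _ r]) auto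
  qed
  then show ?thesis
    using f(1) unfolding analytic_map_on_def by fastforce
qed

lemma lift_differentiable:
  assumes \<psi>: "analytic_map_on m B m B UNIV \<psi>"
    and f: "continuous_on \<Sigma> f" "\<And>x. x \<in> \<Sigma> \<Longrightarrow> \<psi> (\<iota> x) = \<iota> (f x)"
    and UV: "(U, c) \<in> A" "(V, d) \<in> A" and x: "x \<in> U \<inter> \<Sigma> \<inter> f -` V"
  obtains D where "((\<lambda>s. d (f (inv_into U c (line_pt s))) 0) has_real_derivative D)
    (at (c x 0) within {s. line_pt s \<in> c ` (U \<inter> \<Sigma> \<inter> f -` V)})"
proof -
  let ?T = "{s. line_pt s \<in> c ` (U \<inter> \<Sigma> \<inter> f -` V)}"
  note ch = chart_homeomorphism[OF A UV(1)]
  obtain F r where Fr: "r > 0" "F holomorphic_on ball (of_real (c x 0)) r"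
    "\<And>u. u \<in> U \<inter> \<Sigma> \<inter> f -` V \<Longrightarrow> \<bar>c u 0 - c x 0\<bar> < r \<Longrightarrow> F (of_real (c u 0)) = of_real (d (f u) 0)"
    by (rule lift_extends_holomorphically[OF \<psi> f UV x]) blast+
  show thesis
  proof (rule that[OF holomorphic_restrict_real_derivative[OF Fr(2,1)]])
    show "c x 0 \<in> ?T" using ch(4)[of x] x by auto
    fix s assume s: "s \<in> ?T" "\<bar>s - c x 0\<bar> < r"
    then obtain u where u: "u \<in> U \<inter> \<Sigma> \<inter> f -` V" "line_pt s = c u" by blast
    then have "c u 0 = s" by (metis line_pt_def)
    moreover have "inv_into U c (line_pt s) = u" using u ch(3) by simp
    ultimately show "F (of_real s) = of_real (d (f (inv_into U c (line_pt s))) 0)"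
      using Fr(3)[OF u(1)] s(2) by simp
  qed
qed

text \<open>Differentiating \<open>h (f x) = x\<close> in charts gives \<open>D' * D = 1\<close>,
  where \<open>D'\<close> exists because \<open>h\<close> is itself a lift, of
  \<open>\<psi>'\<close>. Comparing with the derivative of the identity uses uniqueness, hence the
  limit point assumption.\<close>

lemma lift_immersive:
  assumes \<psi>: "analytic_map_on m B m B UNIV \<psi>" "analytic_map_on m B m B UNIV \<psi>'"
    and hom: "homeomorphism \<Sigma> \<Sigma>' f h"
    and f: "\<And>x. x \<in> \<Sigma> \<Longrightarrow> \<psi> (\<iota> x) = \<iota> (f x)" and h: "\<And>y. y \<in> \<Sigma>' \<Longrightarrow> \<psi>' (\<iota> y) = \<iota> (h y)"
    and lim: "\<And>x. x \<in> \<Sigma> \<Longrightarrow> x islimpt \<Sigma>"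
  shows "immersive_on A 1 A \<Sigma> f"
proof -
  have "\<exists>j<1. \<exists>D. D \<noteq> 0 \<and> ((\<lambda>s. d (f (inv_into U c (line_pt s))) j) has_real_derivative D)
      (at (c x 0) within {s. line_pt s \<in> c ` (U \<inter> \<Sigma> \<inter> f -` V)})"
    if UV: "(U, c) \<in> A" "(V, d) \<in> A" and x: "x \<in> U" "x \<in> \<Sigma>" "f x \<in> V" for U c V d x
  proof -
  let ?Z = "U \<inter> \<Sigma> \<inter> f -` V" and ?Z' = "V \<inter> \<Sigma>' \<inter> h -` U"
  let ?T = "{s. line_pt s \<in> c ` ?Z}" and ?T' = "{s. line_pt s \<in> d ` ?Z'}"
  let ?p = "\<lambda>s. d (f (inv_into U c (line_pt s))) 0" and ?q = "\<lambda>s. c (h (inv_into V d (line_pt s))) 0"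
  note chU = chart_homeomorphism[OF A UV(1)] and chV = chart_homeomorphism[OF A UV(2)]
  have hf: "h (f u) = u" "f u \<in> \<Sigma>'" if "u \<in> \<Sigma>" for u
    using hom that by (auto simp: homeomorphism_def)
  have fc: "continuous_on \<Sigma> f" and hc: "continuous_on \<Sigma>' h"
    using hom by (auto simp: homeomorphism_def)
  obtain D where D: "(?p has_real_derivative D) (at (c x 0) within ?T)"
    using lift_differentiable[OF \<psi>(1) fc f UV, of x] x by blast
  obtain D' where D': "(?q has_real_derivative D') (at (d (f x) 0) within ?T')"
    using lift_differentiable[OF \<psi>(2) hc h UV(2,1), of "f x"] x hf by auto
  have px: "?p (c x 0) = d (f x) 0"
    using chU(3) chU(4)[OF x(1)] x(1) by (metis inv_into_f_f)
  have T: "\<exists>u\<in>?Z. s = c u 0 \<and> inv_into U c (line_pt s) = u" if s: "s \<in> ?T" for s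
  proof -
    obtain u where u: "u \<in> ?Z" "line_pt s = c u" using s by blast
    then have "c u 0 = s" by (metis line_pt_def)
    then show ?thesis using u chU(3) by auto
  qed
  have "?p ` ?T \<subseteq> ?T'"
  proof (rule image_subsetI)
    fix s assume "s \<in> ?T"
    then obtain u where u: "u \<in> ?Z" "inv_into U c (line_pt s) = u" using T[of s] by blast
    then have "d (f u) = line_pt (d (f u) 0)" using chV(4) by blast
    moreover have "f u \<in> ?Z'" using u hf by auto
    ultimately show "?p s \<in> ?T'" using u by (metis image_eqI mem_Collect_eq)
  qed
  then have "(?q has_real_derivative D') (at (?p (c x 0)) within ?p ` ?T)"
    using has_field_derivative_subset[OF D'] px by simp
  then have "(?q \<circ> ?p has_real_derivative D' * D) (at (c x 0) within ?T)"
    using D by (rule DERIV_image_chain)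
  moreover have xT: "c x 0 \<in> ?T" using chU(4)[of x] x by auto
  ultimately have "((\<lambda>s. s) has_real_derivative D' * D) (at (c x 0) within ?T)"
  proof (rule has_field_derivative_transform_within[OF _ zero_less_one])
    fix s assume "s \<in> ?T"
    then obtain u where u: "u \<in> ?Z" "s = c u 0" "inv_into U c (line_pt s) = u" using T by blast
    then have "inv_into V d (line_pt (d (f u) 0)) = f u"
      using chV(3,4) by (metis IntD2 inv_into_f_f vimageD)
    then show "(?q \<circ> ?p) s = s" using u hf by auto
  qed
  moreover have "at (c x 0) within ?T \<noteq> bot"
  proof -
    obtain Q where Q: "open Q" "Q \<inter> \<Sigma> = f -` V \<inter> \<Sigma>"
      using fc chV(2) unfolding continuous_on_open_invariant by blast
    then have "x islimpt \<Sigma> \<inter> (Q \<inter> U)"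
      using islimpt_Int_open[OF lim[OF x(2)], of "Q \<inter> U"] chU(2) x by blast
    moreover have "\<Sigma> \<inter> (Q \<inter> U) \<subseteq> ?Z" using Q by blast
    ultimately have "c x 0 islimpt (\<lambda>u. c u 0) ` ?Z"
      using chart_islimpt[OF A UV(1) x(1)] islimpt_subset by blast
    moreover have "(\<lambda>u. c u 0) ` ?Z \<subseteq> ?T" using chU(4) by fastforce
    ultimately show ?thesis using islimpt_subset by (simp add: trivial_limit_within) blast
  qed
  ultimately have "D' * D = 1"
    using has_field_derivative_unique DERIV_ident by blast
  then have "D \<noteq> 0" by auto
  then show ?thesis using D by auto
  qed
  then show ?thesis unfolding immersive_on_def by blast
qed

text \<open>Applying \<open>\<psi>'\<close> to the relation for \<open>f\<close> produces the
  relation for \<open>h\<close>, so the two directions are symmetric. Segments have no isolated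
  points, being connected and nondegenerate.\<close>

lemma lift_diffeo:
  assumes \<psi>: "analytic_map_on m B m B UNIV \<psi>" "analytic_map_on m B m B UNIV \<psi>'"
    and inv: "\<And>x. \<psi>' (\<psi> x) = x"
    and hom: "homeomorphism \<Sigma> \<Sigma>' f h"
    and f: "\<And>x. x \<in> \<Sigma> \<Longrightarrow> \<psi> (\<iota> x) = \<iota> (f x)"
    and seg: "segment \<Sigma>"
  shows "analytic_diffeo A \<Sigma> \<Sigma>' f"
proof -
  have fc: "continuous_on \<Sigma> f" and hc: "continuous_on \<Sigma>' h" and \<Sigma>': "f ` \<Sigma> = \<Sigma>'"
    and hf: "\<And>x. x \<in> \<Sigma> \<Longrightarrow> h (f x) = x" and inj: "inj_on f \<Sigma>"
    using hom by (auto simp: homeomorphism_def intro: inj_on_inverseI)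
  have h: "\<psi>' (\<iota> y) = \<iota> (h y)" if "y \<in> \<Sigma>'" for y
    using that \<Sigma>' hf f inv by (metis imageE)
  obtain a b where ab: "a \<in> \<Sigma>" "b \<in> \<Sigma>" "a \<noteq> b" and con: "connected \<Sigma>"
    using seg by (auto simp: segment_def)
  have con': "connected \<Sigma>'" using con fc \<Sigma>' connected_continuous_image by blast
  have ab': "f a \<in> \<Sigma>'" "f b \<in> \<Sigma>'" "f a \<noteq> f b" using ab \<Sigma>' inj by (auto dest: inj_onD)
  have lim: "x islimpt \<Sigma>" if "x \<in> \<Sigma>" for x
    using islimpt_connected[OF con that] ab by blast
  have lim': "x islimpt \<Sigma>'" if "x \<in> \<Sigma>'" for x
    using islimpt_connected[OF con' that] ab' by blast
  show ?thesis
    unfolding analytic_diffeo_def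
    using hom lift_analytic[OF \<psi>(1) fc f] lift_analytic[OF \<psi>(2) hc h]
      lift_immersive[OF \<psi> hom f h lim]
      lift_immersive[OF \<psi>(2,1) homeomorphism_symD[OF hom] h f lim'] by blast
qed

end

section \<open>Maximal reparametrisations\<close>

text \<open>The purely topological half of the argument; analyticity enters only through
  \<open>ext\<close>, which continues a solution beyond parameters that are inner on both
  sides.\<close>

lemma maximal_reparametrisation:
  fixes p q :: "real \<Rightarrow> 'm::t2_space"
  assumes A: "is_interval A" "A \<subseteq> {0..}" "0 \<in> A" and B: "is_interval B" "B \<subseteq> {0..}" "0 \<in> B"
    and p: "continuous_on A p" "inj_on p A" and q: "continuous_on B q" "inj_on q B" and pq: "p 0 = q 0"
    and k: "k \<in> A" "k > 0" and h0: "continuous_on {0..k} h0" "h0 ` {0..k} \<subseteq> B" "\<And>t. t \<in> {0..k} \<Longrightarrow> p t = q (h0 t)"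
    and ext: "\<And>a a1 b1 h. 0 < a \<Longrightarrow> a < a1 \<Longrightarrow> a1 \<in> A \<Longrightarrow> 0 < h a \<Longrightarrow> h a < b1 \<Longrightarrow> b1 \<in> B \<Longrightarrow>
       continuous_on {0..a} h \<Longrightarrow> h ` {0..a} \<subseteq> B \<Longrightarrow> (\<And>t. t \<in> {0..a} \<Longrightarrow> p t = q (h t)) \<Longrightarrow>
       \<exists>a'>a. \<exists>h'. a' \<in> A \<and> continuous_on {a..a'} h' \<and> h' ` {a..a'} \<subseteq> B \<and> (\<forall>t\<in>{a..a'}. p t = q (h' t))"
  obtains E h where "E \<subseteq> A" "is_interval E" "{0..k} \<subseteq> E" "continuous_on E h" "strict_mono_on E h" "h 0 = 0"
    "h ` E \<subseteq> B" "\<And>t. t \<in> E \<Longrightarrow> p t = q (h t)" "E = A \<or> h ` E = B"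
proof -
  define h where "h = (\<lambda>t. inv_into B q (p t))"
  \<comment> \<open>Continuity is imposed separately: \<open>q\<close> is a continuous injection
    whose inverse may jump.\<close>
  define E where "E = {u \<in> A. continuous_on {0..u} h \<and> (\<forall>t\<in>{0..u}. p t \<in> q ` B)}"
  have h_eq: "h t = v" if "v \<in> B" "p t = q v" for t v
    using that q(2) by (simp add: h_def)
  have hB: "h t \<in> B" "p t = q (h t)" if "p t \<in> q ` B" for t
    using that by (auto simp: h_def inv_into_into f_inv_into_f)
  \<comment> \<open>Injectivity of \<open>q\<close> makes lifts unique, so any continuous lift is a
    piece of \<open>h\<close>; this is what allows solutions to be glued.\<close>
  have EI: "u \<in> E" if "u \<in> A" "continuous_on {0..u} g" "g ` {0..u} \<subseteq> B" "\<And>t. t \<in> {0..u} \<Longrightarrow> p t = q (g t)" for u g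
  proof -
    have "g t = h t" if "t \<in> {0..u}" for t
      using h_eq[of "g t" t] that \<open>g ` {0..u} \<subseteq> B\<close> \<open>\<And>t. t \<in> {0..u} \<Longrightarrow> p t = q (g t)\<close> by force
    then have "continuous_on {0..u} h" using that(2) by (rule continuous_on_eq[rotated])
    then show ?thesis using that by (auto simp: E_def)
  qed
  have Icc: "{0..u} \<subseteq> A" if "u \<in> A" for u
    using A that by (meson atLeastAtMost_iff mem_is_interval_1_I subsetI)
  have E0: "0 \<le> u" if "u \<in> E" for u using that A by (auto simp: E_def)
  have down: "t \<in> E" if "u \<in> E" "0 \<le> t" "t \<le> u" for t u
  proof -
    have "{0..t} \<subseteq> {0..u}" using that by auto
    moreover have "t \<in> A" using Icc[of u] that by (auto simp: E_def)
    ultimately show ?thesis using that continuous_on_subset by (fastforce simp: E_def)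
  qed
  have kE: "k \<in> E" using EI[OF k(1) h0] .
  have pE: "p t \<in> q ` B" if "t \<in> E" for t using that E0[OF that] by (auto simp: E_def)
  have EA: "E \<subseteq> A" by (auto simp: E_def)
  have intE: "is_interval E"
    unfolding is_interval_1 using down E0 by (meson order_trans)
  \<comment> \<open>Membership of \<open>u\<close> in \<open>E\<close> gives continuity at
    \<open>u\<close> from the left only. A later point \<open>v\<close> of \<open>E\<close> makes it
    two-sided, and without one \<open>E\<close> has nothing to the right of
    \<open>u\<close>.\<close>
  have contE: "continuous_on E h"
    unfolding continuous_on_eq_continuous_within
  proof
    fix u assume u: "u \<in> E"
    show "continuous (at u within E) h"
    proof (cases "\<exists>v\<in>E. u < v")
      case True
      then obtain v where v: "v \<in> E" "u < v" by blast
      have "at u within E = at u within {0..v}"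
        by (rule at_within_nhd[of u "{..<v}"]) (use v(2) down[OF v(1)] E0 in auto)
      moreover have "continuous (at u within {0..v}) h"
        using v u E0[OF u] by (auto simp: E_def continuous_on_eq_continuous_within)
      ultimately show ?thesis by simp
    next
      case False
      then have "E \<subseteq> {0..u}" using E0 by force
      moreover have "continuous (at u within {0..u}) h"
        using u E0[OF u] by (auto simp: E_def continuous_on_eq_continuous_within)
      ultimately show ?thesis using continuous_within_subset by blast
    qed
  qed
  have injE: "inj_on h E"
  proof (rule inj_onI)
    fix s t assume "s \<in> E" "t \<in> E" "h s = h t"
    then have "p s = p t" using hB(2)[OF pE] by metis
    then show "s = t" using p(2) EA \<open>s \<in> E\<close> \<open>t \<in> E\<close> by (auto dest: inj_onD)
  qed
  have h00: "h 0 = 0" using h_eq[OF B(3) pq] .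
  have E00: "0 \<in> E" using down[OF kE] k by simp
  have hBE: "h t \<in> B" if "t \<in> E" for t using hB(1)[OF pE[OF that]] .
  then have hpos: "0 \<le> h t" if "t \<in> E" for t using that B by auto
  \<comment> \<open>A continuous injection on an interval is strictly monotone; decreasing is
    impossible because \<open>h\<close> starts at \<open>0\<close>, the least element of
    \<open>B\<close>.\<close>
  have smE: "strict_mono_on E h"
  proof -
    have "\<not> strict_antimono_on E h"
    proof
      assume "strict_antimono_on E h"
      then have "h k < h 0" using E00 kE k(2) by (auto simp: monotone_on_def)
      then show False using h00 hpos[OF kE] by simp
    qed
    then show ?thesis using injective_eq_monotone_map[OF intE contE] injE by blast
  qed
  have mono: "h s < h t" if "s \<in> E" "t \<in> E" "s < t" for s t
    using smE that by (auto simp: strict_mono_on_def)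
  have maximal: "E = A \<or> h ` E = B"
  proof (rule ccontr)
    assume "\<not> (E = A \<or> h ` E = B)"
    then obtain a1 b1 where a1: "a1 \<in> A" "a1 \<notin> E" and b1: "b1 \<in> B" "b1 \<notin> h ` E"
      using EA hBE by blast
    have ub: "u < a1" if "u \<in> E" for u
      using that a1 down[OF that, of a1] A by (metis atLeast_iff linorder_not_less subsetD)
    have "connected (h ` E)"
      using intE contE connected_continuous_image is_interval_connected by blast
    then have inth: "is_interval (h ` E)" by (simp add: is_interval_connected_1)
    have hub: "h u < b1" if "u \<in> E" for u
    proof (rule ccontr)
      assume "\<not> h u < b1"
      then have "b1 \<in> h ` E"
        using inth b1 B(2) h00 E00 that by (intro mem_is_interval_1_I[of "h ` E" "h 0" "h u" b1]) auto
      then show False using b1 by simp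
    qed
    \<comment> \<open>Thanks to \<open>a1\<close> and \<open>b1\<close> both suprema are finite and
      lie in \<open>A\<close> and \<open>B\<close>. By monotonicity \<open>b\<close> is the only
      candidate for the value of \<open>h\<close> at \<open>a\<close>.\<close>
    define a where "a = Sup E"
    define b where "b = Sup (h ` E)"
    have bddE: "bdd_above E" and bddh: "bdd_above (h ` E)"
      using ub hub by (auto intro!: bdd_aboveI2[of E "\<lambda>x. x" a1, simplified] bdd_aboveI2 less_imp_le)
    have le_a: "u \<le> a" if "u \<in> E" for u
      unfolding a_def using that bddE by (rule cSup_upper)
    have le_b: "h u \<le> b" if "u \<in> E" for u
      unfolding b_def using that bddh by (auto intro: cSup_upper)
    have "a \<le> a1" unfolding a_def using E00 ub by (intro cSup_least) (auto intro: less_imp_le)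
    have "b \<le> b1" unfolding b_def using E00 hub by (intro cSup_least) (auto intro: less_imp_le)
    have a0: "0 < a" using le_a[OF kE] k by simp
    have b0: "0 < b" using le_b[OF kE] mono[OF E00 kE k(2)] h00 by simp
    have aA: "a \<in> A" using Icc[OF a1(1)] a0 \<open>a \<le> a1\<close> by auto
    have bB: "b \<in> B"
      using mem_is_interval_1_I[OF B(1,3) b1(1)] b0 \<open>b \<le> b1\<close> by simp
    have lt_aE: "t \<in> E" if t: "0 \<le> t" "t < a" for t
    proof -
      obtain u where "u \<in> E" "t < u" using t(2) E00 less_cSup_iff[of E t] bddE unfolding a_def by blast
      then show ?thesis using down t by simp
    qed
    have aE: "a \<in> E"
    proof (rule ccontr)
      assume naE: "a \<notin> E"
      define g where "g = h(a := b)"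
      have lim: "(h \<longlongrightarrow> b) (at a within {0..<a})"
      proof (rule tendstoI)
        fix e :: real assume e: "e > 0"
        then obtain v where v: "v \<in> E" "b - e < h v"
          using less_cSup_iff[of "h ` E" "b - e"] bddh E00 unfolding b_def by auto
        have va: "v < a" using le_a[OF v(1)] naE v(1) by (metis order_less_le)
        show "\<forall>\<^sub>F t in at a within {0..<a}. dist (h t) b < e"
          unfolding eventually_at
        proof (intro exI[of _ "a - v"] conjI ballI impI)
          fix t assume t: "t \<in> {0..<a}" "t \<noteq> a \<and> dist t a < a - v"
          then have "t \<in> E" "v < t" using lt_aE by (auto simp: dist_real_def)
          then show "dist (h t) b < e"
            using mono[OF v(1), of t] le_b[of t] v(2) by (simp add: dist_real_def)
        qed (use va in auto)
      qed
      have nt: "at a within {0..<a} \<noteq> bot"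
        using a0 by (simp add: at_within_eq_bot_iff)
      have "(p \<longlongrightarrow> p a) (at a within {0..<a})"
      proof (rule tendsto_within_subset)
        show "(p \<longlongrightarrow> p a) (at a within A)" using p(1) aA by (simp add: continuous_on_def)
      qed (use Icc[OF aA] in auto)
      moreover have "(p \<longlongrightarrow> q b) (at a within {0..<a})"
      proof -
        \<comment> \<open>Composing with the limit of \<open>q\<close> at \<open>b\<close> requires
          \<open>h t \<noteq> b\<close>. The midpoint of \<open>t\<close> and \<open>a\<close> still
          lies in \<open>E\<close>, so strict monotonicity keeps \<open>h t\<close> below
          \<open>b\<close>.\<close>
        have "filterlim h (at b within B) (at a within {0..<a})"
          unfolding filterlim_at
        proof
          show "\<forall>\<^sub>F t in at a within {0..<a}. h t \<in> B \<and> h t \<noteq> b"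
            unfolding eventually_at
          proof (intro exI[of _ 1] conjI ballI impI)
            fix t assume "t \<in> {0..<a}"
            then have t: "t \<in> E" "(t + a) / 2 \<in> E" "t < (t + a) / 2" using lt_aE by auto
            show "h t \<in> B" using hBE t by simp
            show "h t \<noteq> b" using mono[OF t] le_b[OF t(2)] by simp
          qed auto
        qed (rule lim)
        moreover have "(q \<longlongrightarrow> q b) (at b within B)" using q(1) bB by (simp add: continuous_on_def)
        ultimately have "((\<lambda>t. q (h t)) \<longlongrightarrow> q b) (at a within {0..<a})"
          by (rule filterlim_compose[rotated])
        then show ?thesis
          by (rule tendsto_cong[THEN iffD1, rotated])
             (auto simp: eventually_at intro!: exI[of _ 1] hB(2)[OF pE, symmetric] lt_aE)
      qed
      \<comment> \<open>Here the Hausdorff property of the target enters: \<open>p\<close> has both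
        limits as \<open>t\<close> tends to \<open>a\<close>.\<close>
      ultimately have pab: "p a = q b" using tendsto_unique[OF nt] by blast
      have ha: "h a = b" using h_eq[OF bB pab] .
      have "continuous_on {0..a} h"
        unfolding continuous_on_eq_continuous_within
      proof
        fix t assume t: "t \<in> {0..a}"
        show "continuous (at t within {0..a}) h"
        proof (cases "t = a")
          case True
          have "at a within {0..a} = at a within {0..<a}"
            by (rule at_within_nhd[of a UNIV]) auto
          then show ?thesis using True lim ha by (simp add: continuous_within)
        next
          case False
          then have "t < a" using t by simp
          have "at t within {0..a} = at t within E"
            by (rule at_within_nhd[of t "{..<a}"]) (use \<open>t < a\<close> lt_aE E0 in auto)
          then show ?thesis
            using contE lt_aE[of t] t \<open>t < a\<close> by (simp add: continuous_on_eq_continuous_within)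
        qed
      qed
      then have "a \<in> E"
      proof (rule EI[OF aA])
        show "h ` {0..a} \<subseteq> B" using lt_aE hBE ha bB by (force simp: order_le_less)
        show "p t = q (h t)" if "t \<in> {0..a}" for t
          using that lt_aE[of t] hB(2)[OF pE] pab ha by (cases "t = a") auto
      qed
      then show False using naE by simp
    qed
    have ca: "continuous_on {0..a} h" and pa: "\<And>t. t \<in> {0..a} \<Longrightarrow> p t \<in> q ` B" using aE by (auto simp: E_def)
    have "\<exists>a'>a. \<exists>h'. a' \<in> A \<and> continuous_on {a..a'} h' \<and> h' ` {a..a'} \<subseteq> B \<and> (\<forall>t\<in>{a..a'}. p t = q (h' t))"
    proof (rule ext[OF a0 ub[OF aE] a1(1) _ hub[OF aE] b1(1) ca])
      show "0 < h a" using mono[OF E00 aE a0] h00 by simp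
    qed (use hB pa in auto)
    then obtain a' h' where a': "a < a'" "a' \<in> A" "continuous_on {a..a'} h'" "h' ` {a..a'} \<subseteq> B"
      "\<And>t. t \<in> {a..a'} \<Longrightarrow> p t = q (h' t)" by blast
    have hh': "h' t = h t" if "t \<in> {a..a'}" for t
      using h_eq[of "h' t" t] a'(4,5) that by (metis image_subset_iff)
    then have "continuous_on {a..a'} h" using a'(3) by (rule continuous_on_eq[rotated])
    then have "continuous_on ({0..a} \<union> {a..a'}) h"
      using ca by (intro continuous_on_closed_Un) auto
    moreover have un: "{0..a} \<union> {a..a'} = {0..a'}" using a0 a'(1) by auto
    ultimately have "a' \<in> E"
    proof (intro EI[OF a'(2)])
      show "h ` {0..a'} \<subseteq> B"
        unfolding un[symmetric] using hB(1)[OF pa] hh' a'(4) by (auto simp: image_subset_iff)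
      show "p t = q (h t)" if "t \<in> {0..a'}" for t
        using that hB(2)[OF pa, of t] a'(5)[of t] hh'[of t] by (cases "t \<le> a") auto
    qed simp
    then show False using le_a a'(1) by force
  qed
  show thesis
  proof (rule that[OF EA intE _ contE smE h00 _ hB(2)[OF pE] maximal])
    show "{0..k} \<subseteq> E" using down[OF kE] by auto
    show "h ` E \<subseteq> B" using hBE by auto
  qed auto
qed

section \<open>Continuing a reparametrisation past an inner point\<close>

text \<open>The parameters of the two pieces form intervals sharing only that of \<open>z\<close>,
  hence lie on opposite sides of it. A translation moves \<open>z\<close> to \<open>0\<close>, and a
  reflection, if necessary, puts \<open>Sm\<close> on the nonpositive side.\<close>

lemma interval_splitting_at_point:
  fixes \<upsilon> :: "real \<Rightarrow> 's::topological_space" and Sm Sp :: "'s set"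
  assumes D: "is_interval_param D \<upsilon>" and con: "connected Sm" "connected Sp"
    and un: "Sm \<union> Sp = UNIV" and int: "Sm \<inter> Sp = {z}"
    and a: "a \<in> Sm" "a \<noteq> z" and b: "b \<in> Sp" "b \<noteq> z"
  obtains I and \<gamma> :: "real \<Rightarrow> 's" and \<gamma>' where "is_interval I" "homeomorphism I UNIV \<gamma> \<gamma>'" "0 \<in> I" "\<gamma> 0 = z"
    "Sm = \<gamma> ` (I \<inter> {..0})" "Sp = \<gamma> ` (I \<inter> {0..})"
proof -
  have iD: "is_interval D" and hm: "homeomorphic_map (top_of_set D) euclidean \<upsilon>"
    using D by (auto simp: is_interval_param_def)
  obtain \<upsilon>' where maps: "homeomorphic_maps (top_of_set D) euclidean \<upsilon> \<upsilon>'"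
    using hm homeomorphic_map_maps by blast
  have cont: "continuous_on D \<upsilon>" "continuous_on UNIV \<upsilon>'" and \<upsilon>'D: "\<And>x. \<upsilon>' x \<in> D"
    and inv: "\<And>t. t \<in> D \<Longrightarrow> \<upsilon>' (\<upsilon> t) = t" "\<And>x. \<upsilon> (\<upsilon>' x) = x"
    using maps by (auto simp: homeomorphic_maps_def continuous_map_in_subtopology)
  define c where "c = \<upsilon>' z"
  \<comment> \<open>The position of \<open>a\<close> relative to \<open>z\<close> decides the
    orientation; as \<open>\<sigma>\<close> is its own inverse, \<open>\<gamma>\<close> and
    \<open>\<gamma>'\<close> share it.\<close>
  define \<sigma> where "\<sigma> = (if \<upsilon>' a < c then 1 else - 1 :: real)"
  have \<sigma>: "\<sigma> * \<sigma> = 1" by (simp add: \<sigma>_def)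
  define \<gamma> where "\<gamma> = (\<lambda>t. \<upsilon> (c + \<sigma> * t))"
  define \<gamma>' where "\<gamma>' = (\<lambda>x. \<sigma> * (\<upsilon>' x - c))"
  define I where "I = {t. c + \<sigma> * t \<in> D}"
  have \<sigma>2: "\<sigma> * (\<sigma> * w) = w" for w using \<sigma> by (simp flip: mult.assoc)
  have inv': "\<gamma> (\<gamma>' x) = x" "\<gamma>' x \<in> I" for x
    using inv(2) \<upsilon>'D by (auto simp: \<gamma>_def \<gamma>'_def I_def \<sigma>2)
  have inv'': "\<gamma>' (\<gamma> t) = t" if "t \<in> I" for t
    using inv(1) that by (simp add: \<gamma>_def \<gamma>'_def I_def \<sigma>2)
  have inj: "x = y" if "\<gamma>' x = \<gamma>' y" for x y using inv'(1) that by metis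
  have intI: "is_interval I"
  proof -
    have "t \<in> I" if "s \<in> I" "u \<in> I" "s \<le> t" "t \<le> u" for s t u
    proof (cases "\<upsilon>' a < c")
      case True
      then show ?thesis
        using mem_is_interval_1_I[OF iD, of "c + s" "c + u" "c + t"] that by (simp add: I_def \<sigma>_def)
    next
      case False
      then show ?thesis
        using mem_is_interval_1_I[OF iD, of "c - u" "c - s" "c - t"] that by (simp add: I_def \<sigma>_def)
    qed
    then show ?thesis unfolding is_interval_1 by blast
  qed
  have c\<gamma>': "continuous_on UNIV \<gamma>'"
    unfolding \<gamma>'_def by (intro continuous_intros cont(2))
  have hom: "homeomorphism I UNIV \<gamma> \<gamma>'"
  proof (rule homeomorphismI)
    show "continuous_on I \<gamma>"
      unfolding \<gamma>_def by (rule continuous_on_compose2[OF cont(1)]) (auto simp: I_def intro!: continuous_intros)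
  qed (use inv' inv'' c\<gamma>' in auto)
  have z0: "\<gamma>' z = 0" by (simp add: \<gamma>'_def c_def)
  have neg: "\<gamma>' a < 0"
  proof -
    have "\<gamma>' a \<noteq> 0" using inj[of a z] a z0 by auto
    moreover have "\<gamma>' a \<le> 0" by (auto simp: \<gamma>'_def \<sigma>_def)
    ultimately show ?thesis by simp
  qed
  have intm: "is_interval (\<gamma>' ` Sm)" and intp: "is_interval (\<gamma>' ` Sp)"
    using con connected_continuous_image[OF continuous_on_subset[OF c\<gamma>']]
    by (simp_all add: is_interval_connected_1)
  have zS: "z \<in> Sm" "z \<in> Sp" using int by auto
  have both: "w = 0" if w: "w \<in> \<gamma>' ` Sm" "w \<in> \<gamma>' ` Sp" for w
  proof -
    obtain u v where "u \<in> Sm" "w = \<gamma>' u" "v \<in> Sp" "w = \<gamma>' v" using w by blast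
    moreover from this have "u = v" using inj by metis
    ultimately show ?thesis using int z0 by auto
  qed
  have p_pos: "0 \<le> \<gamma>' x" if x: "x \<in> Sp" for x
  proof (rule ccontr)
    assume "\<not> 0 \<le> \<gamma>' x"
    \<comment> \<open>The larger of the two negative parameters lies between each of them and
      \<open>0\<close>, hence in both intervals, although these meet only in
      \<open>0\<close>.\<close>
    then have w: "max (\<gamma>' x) (\<gamma>' a) < 0" using neg by simp
    have "max (\<gamma>' x) (\<gamma>' a) \<in> \<gamma>' ` Sm"
      by (rule mem_is_interval_1_I[OF intm, of "\<gamma>' a" "\<gamma>' z"]) (use a zS z0 w in auto)
    moreover have "max (\<gamma>' x) (\<gamma>' a) \<in> \<gamma>' ` Sp"
      by (rule mem_is_interval_1_I[OF intp, of "\<gamma>' x" "\<gamma>' z"]) (use x zS z0 w in auto)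
    ultimately show False using both w by force
  qed
  have "\<gamma>' b \<noteq> 0" using inj[of b z] b z0 by auto
  then have pos: "0 < \<gamma>' b" using p_pos[OF b(1)] by simp
  have m_neg: "\<gamma>' x \<le> 0" if x: "x \<in> Sm" for x
  proof (rule ccontr)
    assume "\<not> \<gamma>' x \<le> 0"
    then have w: "min (\<gamma>' x) (\<gamma>' b) > 0" using pos by simp
    have "min (\<gamma>' x) (\<gamma>' b) \<in> \<gamma>' ` Sp"
      by (rule mem_is_interval_1_I[OF intp, of "\<gamma>' z" "\<gamma>' b"]) (use b zS z0 w in auto)
    moreover have "min (\<gamma>' x) (\<gamma>' b) \<in> \<gamma>' ` Sm"
      by (rule mem_is_interval_1_I[OF intm, of "\<gamma>' z" "\<gamma>' x"]) (use x zS z0 w in auto)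
    ultimately show False using both w by force
  qed
  have \<gamma>0: "\<gamma> 0 = z" using inv'(1)[of z] z0 by simp
  have S: "\<gamma> t \<in> Sm \<or> \<gamma> t \<in> Sp" for t using un by blast
  have Sm: "Sm = \<gamma> ` (I \<inter> {..0})"
  proof (intro equalityI subsetI)
    fix x assume "x \<in> Sm"
    then show "x \<in> \<gamma> ` (I \<inter> {..0})"
      using inv'[of x] m_neg by (intro image_eqI[of _ _ "\<gamma>' x"]) auto
  next
    fix x assume "x \<in> \<gamma> ` (I \<inter> {..0})"
    then obtain t where t: "x = \<gamma> t" "t \<in> I" "t \<le> 0" by auto
    show "x \<in> Sm"
    proof (rule ccontr)
      assume "x \<notin> Sm"
      then have "x \<in> Sp" using un by blast
      then have "t = 0" using p_pos[of x] t inv'' by simp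
      then show False using t \<gamma>0 zS \<open>x \<notin> Sm\<close> by simp
    qed
  qed
  have Sp: "Sp = \<gamma> ` (I \<inter> {0..})"
  proof (intro equalityI subsetI)
    fix x assume "x \<in> Sp"
    then show "x \<in> \<gamma> ` (I \<inter> {0..})"
      using inv'[of x] p_pos by (intro image_eqI[of _ _ "\<gamma>' x"]) auto
  next
    fix x assume "x \<in> \<gamma> ` (I \<inter> {0..})"
    then obtain t where t: "x = \<gamma> t" "t \<in> I" "t \<ge> 0" by auto
    show "x \<in> Sp"
    proof (rule ccontr)
      assume "x \<notin> Sp"
      then have "x \<in> Sm" using un by blast
      then have "t = 0" using m_neg[of x] t inv'' by simp
      then show False using t \<gamma>0 zS \<open>x \<notin> Sp\<close> by simp
    qed
  qed
  show thesis using that[OF intI hom _ \<gamma>0 Sm Sp] inv'(2)[of z] z0 by simp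
qed

lemma homeomorphism_imp_embedding_map:
  assumes "homeomorphism S T f g"
  shows "embedding_map (top_of_set S) euclidean f"
proof -
  have "homeomorphic_maps (top_of_set S) (top_of_set T) f g"
    using assms by (auto simp: homeomorphic_maps_def homeomorphism_def continuous_map_in_subtopology)
  moreover have "f ` S = T" using assms by (simp add: homeomorphism_def)
  ultimately show ?thesis
    unfolding embedding_map_def by (auto simp: homeomorphic_map_maps)
qed

text \<open>On a compact arc a continuous injection into a Hausdorff space is a homeomorphism onto
  its image, so the open part of any such arc in \<open>C\<close> serves.\<close>

lemma segment_contains_embedded_open_segment:
  fixes \<iota> :: "'s::t2_space \<Rightarrow> 'm::t2_space" and \<gamma> :: "real \<Rightarrow> 's"
  assumes I: "is_interval I" "homeomorphism I UNIV \<gamma> \<gamma>'" and C: "segment C"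
    and \<iota>: "continuous_on UNIV \<iota>" "inj \<iota>"
  obtains W where "open W" "segment W" "W \<subseteq> C" "embedding_map (top_of_set W) euclidean \<iota>"
proof -
  have \<gamma>: "continuous_on I \<gamma>" "continuous_on UNIV \<gamma>'" and \<gamma>'I: "\<And>x. \<gamma>' x \<in> I"
    and inv: "\<And>t. t \<in> I \<Longrightarrow> \<gamma>' (\<gamma> t) = t" "\<And>x. \<gamma> (\<gamma>' x) = x"
    using I(2) by (auto simp: homeomorphism_def)
  obtain x y where xy: "x \<in> C" "y \<in> C" "x \<noteq> y" and con: "connected C"
    using C by (auto simp: segment_def)
  then have "\<gamma>' x \<noteq> \<gamma>' y" using inv(2) by metis
  then obtain s t where st: "s \<in> \<gamma>' ` C" "t \<in> \<gamma>' ` C" "s < t"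
    using xy by (metis imageI linorder_neq_iff)
  have "is_interval (\<gamma>' ` C)"
    using connected_continuous_image[OF continuous_on_subset[OF \<gamma>(2)] con]
    by (simp add: is_interval_connected_1)
  then have sub: "{s..t} \<subseteq> \<gamma>' ` C"
    using mem_is_interval_1_I[OF _ st(1,2)] by auto
  have "\<gamma>' ` C \<subseteq> I" using \<gamma>'I by (rule image_subsetI)
  with sub have subI: "{s..t} \<subseteq> I" by (rule order_trans)
  define W where "W = \<gamma> ` {s<..<t}"
  have "openin (top_of_set I) {s<..<t}"
    using subI by (auto simp: openin_open intro!: exI[of _ "{s<..<t}"])
  then have "openin (top_of_set UNIV) W"
    unfolding W_def by (rule homeomorphism_imp_open_map[OF I(2)])
  then have oW: "open W" by simp
  have "compact (\<gamma> ` {s..t})"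
    by (rule compact_continuous_image[OF continuous_on_subset[OF \<gamma>(1) subI]]) simp
  then obtain k where "homeomorphism (\<gamma> ` {s..t}) (\<iota> ` \<gamma> ` {s..t}) \<iota> k"
    using homeomorphism_compact[of "\<gamma> ` {s..t}" \<iota>] \<iota> by (meson continuous_on_subset inj_on_subset top_greatest)
  then have "homeomorphism W (\<iota> ` W) \<iota> k"
    by (rule homeomorphism_of_subsets) (auto simp: W_def)
  then have emb: "embedding_map (top_of_set W) euclidean \<iota>" by (rule homeomorphism_imp_embedding_map)
  have "segment W"
    unfolding segment_def
  proof
    have "{s<..<t} \<subseteq> I" using subI by auto
    then show "connected W"
      unfolding W_def using \<gamma>(1) connected_continuous_image connected_Ioo continuous_on_subset by blast
    define u v where "u = (2 * s + t) / 3" and "v = (s + 2 * t) / 3"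
    have uv: "u \<in> {s<..<t}" "v \<in> {s<..<t}" "u \<noteq> v" using st(3) by (auto simp: u_def v_def field_simps)
    then have "\<gamma> u \<noteq> \<gamma> v" using inv(1) \<open>{s<..<t} \<subseteq> I\<close> by (metis subsetD)
    then show "\<exists>x\<in>W. \<exists>y\<in>W. x \<noteq> y" using uv unfolding W_def by blast
  qed
  moreover have "W \<subseteq> C" 
  proof -
    have "{s<..<t} \<subseteq> \<gamma>' ` C" using sub by auto
    then show ?thesis unfolding W_def using inv(2) by fastforce
  qed
  ultimately show thesis using that oW emb by blast
qed

text \<open>An overlap of \<open>C\<close> with its translate is also one of
  \<open>\<Sigma>\<close>. Conversely a stabilising \<open>g\<close> fixes \<open>\<iota>\<close>
  pointwise, so any embedded open segment inside \<open>C\<close> is a witness; its existence is the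
  only real content.\<close>

lemma free_segments_subset:
  fixes \<iota> :: "'s::t2_space \<Rightarrow> 'm::t2_space" and \<gamma> :: "real \<Rightarrow> 's"
  assumes "is_interval I" "homeomorphism I UNIV \<gamma> \<gamma>'" and "continuous_on UNIV \<iota>" "inj \<iota>"
    and \<Sigma>: "\<Sigma> \<in> free_segments G \<phi> \<iota>" and C: "segment C" "C \<subseteq> \<Sigma>"
  shows "C \<in> free_segments G \<phi> \<iota>"
proof -
  obtain W where W: "open W" "segment W" "W \<subseteq> C" "embedding_map (top_of_set W) euclidean \<iota>"
    using segment_contains_embedded_open_segment[OF assms(1,2) C(1) assms(3,4)] by blast
  have "overlaps \<phi> \<iota> g C C" if "g \<in> stab_curve G \<phi> \<iota>" for g
  proof -
    have "\<phi> g (\<iota> w) = \<iota> w" for w using that by (auto simp: stab_curve_def stabilizer_def)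
    then have "\<phi> g ` \<iota> ` W = \<iota> ` W" by (simp add: image_image)
    then show ?thesis unfolding overlaps_def using W by blast
  qed
  moreover have "overlaps \<phi> \<iota> g \<Sigma> \<Sigma>" if "overlaps \<phi> \<iota> g C C" for g
    using that C(2) unfolding overlaps_def by (meson order_trans)
  ultimately show ?thesis using \<Sigma> C(1) unfolding free_segments_def by blast
qed

lemma continuous_on_Icc_nhd:
  fixes f :: "real \<Rightarrow> 'a::topological_space"
  assumes "continuous_on {l..u} f" "w \<in> {l..u}" "open N" "f w \<in> N"
  obtains \<delta> where "\<delta> > 0" "\<And>t. t \<in> {l..u} \<Longrightarrow> \<bar>t - w\<bar> \<le> \<delta> \<Longrightarrow> f t \<in> N"
proof -
  have "(f \<longlongrightarrow> f w) (at w within {l..u})" using assms by (simp add: continuous_on_def)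
  then have "\<forall>\<^sub>F t in at w within {l..u}. f t \<in> N" using assms topological_tendstoD by blast
  then obtain d where d: "d > 0" "\<And>t. t \<in> {l..u} \<Longrightarrow> t \<noteq> w \<Longrightarrow> dist t w < d \<Longrightarrow> f t \<in> N"
    unfolding eventually_at by blast
  show thesis
  proof (rule that[of "d / 2"])
    fix t assume "t \<in> {l..u}" "\<bar>t - w\<bar> \<le> d / 2"
    then show "f t \<in> N" using d assms(4) by (cases "t = w") (auto simp: dist_real_def)
  qed (use d in auto)
qed

text \<open>Strict monotonicity places \<open>q w\<close> strictly between the end values, and the
  intermediate value theorem fills the gap.\<close>

lemma continuous_inj_Icc_covers_nhd:
  fixes q :: "real \<Rightarrow> real"
  assumes q: "continuous_on {l..u} q" "inj_on q {l..u}" and w: "l < w" "w < u"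
  obtains \<eta> where "\<eta> > 0" "\<And>s. \<bar>s - q w\<bar> < \<eta> \<Longrightarrow> s \<in> q ` {l..u}"
proof -
  have ends: "q l < q w \<and> q w < q u \<or> q u < q w \<and> q w < q l"
    using injective_eq_monotone_map[of "{l..u}" q] q w by (auto simp: monotone_on_def is_interval_cc)
  have "is_interval (q ` {l..u})"
    using q(1) connected_continuous_image is_interval_connected_1 connected_Icc by blast
  then have mem: "s \<in> q ` {l..u}" if "q l \<le> s \<and> s \<le> q u \<or> q u \<le> s \<and> s \<le> q l" for s
    using mem_is_interval_1_I[of "q ` {l..u}" "q l" "q u" s] mem_is_interval_1_I[of "q ` {l..u}" "q u" "q l" s] that w
    by auto
  show thesis
    by (rule that[of "min \<bar>q w - q l\<bar> \<bar>q u - q w\<bar>"], use ends in force, rule mem, use ends in auto)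
qed

context analytic_curve
begin

text \<open>Provides the hypothesis \<open>ext\<close> of \<open>maximal_reparametrisation\<close>.
  The function \<open>F\<close> from \<open>local_lift\<close> predicts the coordinate of the
  partner beyond \<open>a\<close>; inverting the coordinate along \<open>\<gamma>\<close> turns the
  prediction into a parameter.\<close>

lemma reparametrisation_extends:
  fixes \<gamma> :: "real \<Rightarrow> 's" and h :: "real \<Rightarrow> real"
  assumes \<psi>: "analytic_map_on m B m B UNIV \<psi>"
    and \<gamma>: "homeomorphism I UNIV \<gamma> \<gamma>'"
    and I: "{- a1..b1} \<subseteq> I" and a: "0 < a" "a < a1" and b: "0 < h a" "h a < b1"
    and h: "continuous_on {0..a} h" "h ` {0..a} \<subseteq> I" "\<And>t. t \<in> {0..a} \<Longrightarrow> \<psi> (\<iota> (\<gamma> (- t))) = \<iota> (\<gamma> (h t))"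
  shows "\<exists>a'>a. \<exists>h'. a' \<le> a1 \<and> continuous_on {a..a'} h' \<and> h' ` {a..a'} \<subseteq> {0..b1} \<and>
      (\<forall>t\<in>{a..a'}. \<psi> (\<iota> (\<gamma> (- t))) = \<iota> (\<gamma> (h' t)))"
proof -
  define x y where "x = \<gamma> (- a)" and "y = \<gamma> (h a)"
  have c\<gamma>: "continuous_on I \<gamma>" and inv: "\<And>t. t \<in> I \<Longrightarrow> \<gamma>' (\<gamma> t) = t"
    using \<gamma> by (auto simp: homeomorphism_def)
  have inj\<gamma>: "inj_on \<gamma> I" using inv by (rule inj_on_inverseI)
  have "(\<Union>(U, c)\<in>A. U) = UNIV" using A by (simp add: analytic_manifold_def)
  then have "x \<in> (\<Union>(U, c)\<in>A. U)" "y \<in> (\<Union>(U, c)\<in>A. U)" by simp_all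
  then obtain U c V d where UV: "(U, c) \<in> A" "(V, d) \<in> A" and xy: "x \<in> U" "y \<in> V" by blast
  note chU = chart_homeomorphism[OF A UV(1)] and chV = chart_homeomorphism[OF A UV(2)]
  have cU: "continuous_on U (\<lambda>u. c u 0)" and cV: "continuous_on V (\<lambda>u. d u 0)"
    and injV: "inj_on (\<lambda>u. d u 0) V"
    using chU(1) chV(1) by (auto simp: homeomorphism_def intro: inj_on_inverseI)
  have \<psi>xy: "\<psi> (\<iota> x) = \<iota> y" using h(3)[of a] a(1) by (simp add: x_def y_def)
  obtain F r M N where Fr: "r > 0" "F holomorphic_on ball (of_real (c x 0)) r"
      "F (of_real (c x 0)) = of_real (d y 0)"
    and MN: "open M" "x \<in> M" "open N" "y \<in> N" "N \<subseteq> V"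
    and conv: "\<And>u v. x islimpt {u \<in> U. \<exists>v\<in>N. \<psi> (\<iota> u) = \<iota> v} \<Longrightarrow> u \<in> U \<inter> M \<Longrightarrow> v \<in> N \<Longrightarrow>
       \<bar>c u 0 - c x 0\<bar> < r \<Longrightarrow> F (of_real (c u 0)) = of_real (d v 0) \<Longrightarrow> \<psi> (\<iota> u) = \<iota> v"
    and real: "\<And>s. x islimpt {u \<in> U. \<exists>v\<in>N. \<psi> (\<iota> u) = \<iota> v} \<Longrightarrow> \<bar>s - c x 0\<bar> < r \<Longrightarrow> Im (F (of_real s)) = 0"
    by (rule local_lift[OF A B \<iota>_analytic \<iota>_immersive \<psi> UV(1) xy(1) islimpt_UNIV UV(2) xy(2) islimpt_UNIV \<psi>xy]) blast
  have c\<gamma>1: "continuous_on {0..a1} (\<lambda>t. \<gamma> (- t))"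
    by (rule continuous_on_compose2[OF c\<gamma>]) (use I b in \<open>auto intro!: continuous_intros\<close>)
  have c\<gamma>h: "continuous_on {0..a} (\<lambda>t. \<gamma> (h t))"
    by (rule continuous_on_compose2[OF c\<gamma> h(1) h(2)])

  \<comment> \<open>The old solution just before \<open>a\<close> supplies the accumulation at
    \<open>x\<close>: it traces a nondegenerate connected arc of points that lift, of which
    \<open>x\<close> is an end.\<close>
  have lim: "x islimpt {u \<in> U. \<exists>v\<in>N. \<psi> (\<iota> u) = \<iota> v}"
  proof -
    obtain \<delta>1 where \<delta>1: "\<delta>1 > 0" "\<And>t. t \<in> {0..a} \<Longrightarrow> \<bar>t - a\<bar> \<le> \<delta>1 \<Longrightarrow> \<gamma> (h t) \<in> N"
      using continuous_on_Icc_nhd[OF c\<gamma>h, of a N] a MN by (auto simp: y_def)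
    obtain \<delta>2 where \<delta>2: "\<delta>2 > 0" "\<And>t. t \<in> {0..a1} \<Longrightarrow> \<bar>t - a\<bar> \<le> \<delta>2 \<Longrightarrow> \<gamma> (- t) \<in> U"
      using continuous_on_Icc_nhd[OF c\<gamma>1, of a U] a chU(2) xy by (auto simp: x_def)
    define l where "l = max 0 (max (a - \<delta>1) (a - \<delta>2))"
    have l: "0 \<le> l" "l < a" "a - \<delta>1 \<le> l" "a - \<delta>2 \<le> l" using a \<delta>1 \<delta>2 by (auto simp: l_def)
    let ?X = "(\<lambda>t. \<gamma> (- t)) ` {l..a}"
    have "{l..a} \<subseteq> {0..a1}" using l a by auto
    then have "connected ?X"
      using c\<gamma>1 connected_continuous_image connected_Icc continuous_on_subset by blast
    moreover have "\<gamma> (- l) \<noteq> \<gamma> (- a)"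
      using inj\<gamma> I l a b by (auto dest!: inj_onD)
    ultimately have "x islimpt ?X"
      using l by (intro islimpt_connected[of _ _ "\<gamma> (- l)" "\<gamma> (- a)"]) (auto simp: x_def)
    moreover have "?X \<subseteq> {u \<in> U. \<exists>v\<in>N. \<psi> (\<iota> u) = \<iota> v}"
    proof (rule image_subsetI)
      fix t assume t: "t \<in> {l..a}"
      then have "\<gamma> (h t) \<in> N" "\<gamma> (- t) \<in> U" "t \<in> {0..a}" using \<delta>1(2)[of t] \<delta>2(2)[of t] l a by auto
      then show "\<gamma> (- t) \<in> {u \<in> U. \<exists>v\<in>N. \<psi> (\<iota> u) = \<iota> v}" using h(3) by blast
    qed
    ultimately show ?thesis using islimpt_subset by blast
  qed

  have c\<gamma>2: "continuous_on {0..b1} \<gamma>"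
    by (rule continuous_on_subset[OF c\<gamma>]) (use I a in auto)
  obtain \<delta> where \<delta>: "\<delta> > 0" "\<And>t. t \<in> {0..b1} \<Longrightarrow> \<bar>t - h a\<bar> \<le> \<delta> \<Longrightarrow> \<gamma> t \<in> N"
    using continuous_on_Icc_nhd[OF c\<gamma>2, of "h a" N] b MN by (auto simp: y_def)
  \<comment> \<open>As \<open>h a\<close> is strictly between \<open>0\<close> and
    \<open>b1\<close>, this interval reaches to both sides of it, and the coordinates of its points
    cover a full neighbourhood of that of \<open>y\<close>. At an end point of the curve the
    predicted partner could be missing.\<close>
  define l u where "l = max 0 (h a - \<delta>)" and "u = min b1 (h a + \<delta>)"
  have lu: "0 \<le> l" "l < h a" "h a < u" "u \<le> b1" "{l..u} \<subseteq> {0..b1}" using \<delta> b by (auto simp: l_def u_def)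
  have luI: "{l..u} \<subseteq> I" using lu I a by force
  have luN: "\<gamma> ` {l..u} \<subseteq> N"
    using \<delta>(2) by (auto simp: l_def u_def abs_le_iff)
  define q where "q = (\<lambda>t. d (\<gamma> t) 0)"
  have cq: "continuous_on {l..u} q"
    unfolding q_def by (rule continuous_on_compose2[OF cV continuous_on_subset[OF c\<gamma> luI]]) (use luN MN in auto)
  have injq: "inj_on q {l..u}"
  proof (rule inj_onI)
    fix s t assume st: "s \<in> {l..u}" "t \<in> {l..u}" "q s = q t"
    then have "\<gamma> s \<in> V" "\<gamma> t \<in> V" using luN MN by blast+
    then have "\<gamma> s = \<gamma> t" using injV st(3) by (auto simp: q_def dest: inj_onD)
    then show "s = t" using inj_onD[OF inj\<gamma>] subsetD[OF luI] st by blast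
  qed
  obtain \<eta> where \<eta>: "\<eta> > 0" "\<And>s. \<bar>s - q (h a)\<bar> < \<eta> \<Longrightarrow> s \<in> q ` {l..u}"
    using continuous_inj_Icc_covers_nhd[OF cq injq lu(2,3)] by blast
  obtain q' where q': "homeomorphism {l..u} (q ` {l..u}) q q'"
    using injective_into_1d_eq_homeomorphism[OF cq] injq by (auto simp: convex_imp_path_connected)
  then have cq': "continuous_on (q ` {l..u}) q'" and qq': "\<And>s. s \<in> q ` {l..u} \<Longrightarrow> q (q' s) = s \<and> q' s \<in> {l..u}"
    by (auto simp: homeomorphism_def)

  define Q where "Q = U \<inter> (\<lambda>u. c u 0) -` {s. \<bar>s - c x 0\<bar> < r}"
  have "open {s. \<bar>s - c x 0\<bar> < r}" by (intro open_Collect_less continuous_intros)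
  then have oQ: "open Q" unfolding Q_def using continuous_open_preimage[OF cU chU(2)] by blast
  \<comment> \<open>Taking \<open>Re\<close> loses nothing on \<open>Q\<close>: by
    \<open>real\<close> and \<open>lim\<close> the function \<open>F\<close> is real at these
    coordinates.\<close>
  define H where "H = (\<lambda>u. Re (F (of_real (c u 0))))"
  have cH: "continuous_on Q H"
  proof -
    have "continuous_on Q (\<lambda>u. complex_of_real (c u 0))"
      using cU by (intro continuous_intros continuous_on_subset[OF cU]) (auto simp: Q_def)
    then have "continuous_on Q (\<lambda>u. F (of_real (c u 0)))"
      by (rule continuous_on_compose2[OF holomorphic_on_imp_continuous_on[OF Fr(2)]])
         (auto simp: Q_def dist_norm abs_minus_commute simp flip: of_real_diff)
    then show ?thesis unfolding H_def by (intro continuous_intros)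
  qed
  have "open {s. \<bar>s - q (h a)\<bar> < \<eta>}" by (intro open_Collect_less continuous_intros)
  then have oR: "open (Q \<inter> H -` {s. \<bar>s - q (h a)\<bar> < \<eta>} \<inter> M)"
    using continuous_open_preimage[OF cH oQ] MN(1) by blast
  have "H x = q (h a)" using Fr(3) by (simp add: H_def q_def y_def)
  then have "\<gamma> (- a) \<in> Q \<inter> H -` {s. \<bar>s - q (h a)\<bar> < \<eta>} \<inter> M"
    using xy MN Fr \<eta> by (simp add: Q_def flip: x_def)
  then obtain \<epsilon> where \<epsilon>: "\<epsilon> > 0" "\<And>t. t \<in> {0..a1} \<Longrightarrow> \<bar>t - a\<bar> \<le> \<epsilon> \<Longrightarrow> \<gamma> (- t) \<in> Q \<inter> H -` {s. \<bar>s - q (h a)\<bar> < \<eta>} \<inter> M"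
    using continuous_on_Icc_nhd[OF c\<gamma>1 _ oR, of a] a by auto
  define a' where "a' = min a1 (a + \<epsilon>)"
  have a': "a < a'" "a' \<le> a1" using a \<epsilon> by (auto simp: a'_def)
  have near: "\<gamma> (- t) \<in> Q \<inter> M" "H (\<gamma> (- t)) \<in> q ` {l..u}" if "t \<in> {a..a'}" for t
    using \<epsilon>(2)[of t] \<eta>(2)[of "H (\<gamma> (- t))"] that a by (auto simp: a'_def)
  define h' where "h' = (\<lambda>t. q' (H (\<gamma> (- t))))"
  have "continuous_on {a..a'} (\<lambda>t. H (\<gamma> (- t)))"
  proof (rule continuous_on_compose2[OF cH])
    show "continuous_on {a..a'} (\<lambda>t. \<gamma> (- t))"
      by (rule continuous_on_subset[OF c\<gamma>1]) (use a a' in auto)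
  qed (use near in auto)
  then have ch': "continuous_on {a..a'} h'"
    unfolding h'_def by (rule continuous_on_compose2[OF cq']) (use near in auto)
  have h'lu: "h' t \<in> {l..u}" if "t \<in> {a..a'}" for t
    using qq' near(2)[OF that] by (simp add: h'_def)
  have "\<psi> (\<iota> (\<gamma> (- t))) = \<iota> (\<gamma> (h' t))" if t: "t \<in> {a..a'}" for t
  proof (rule conv[OF lim])
    show "\<gamma> (- t) \<in> U \<inter> M" and s: "\<bar>c (\<gamma> (- t)) 0 - c x 0\<bar> < r" using near(1)[OF t] by (auto simp: Q_def)
    show "\<gamma> (h' t) \<in> N" using h'lu[OF t] luN by blast
    have "d (\<gamma> (h' t)) 0 = H (\<gamma> (- t))" using qq' near(2)[OF t] by (simp add: h'_def q_def)
    then show "F (of_real (c (\<gamma> (- t)) 0)) = of_real (d (\<gamma> (h' t)) 0)"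
      using real[OF lim s] by (simp add: H_def complex_eq_iff)
  qed
  moreover have "h' ` {a..a'} \<subseteq> {0..b1}" using h'lu lu(5) by blast
  ultimately show ?thesis using a' ch' by blast
qed

end

section \<open>The dichotomy\<close>

theorem lemma25:
  fixes G :: "('g::t2_space, 'b) monoid_scheme" and AG :: "'g chart set"
    and AM :: "'m::t2_space chart set"
    and AS :: "'s::{t2_space, second_countable_topology} chart set"
    and \<phi> :: "'g \<Rightarrow> 'm \<Rightarrow> 'm" and \<iota> :: "'s \<Rightarrow> 'm"
    and D :: "real set" and \<upsilon> :: "real \<Rightarrow> 's"
    and nG nM :: nat and z :: 's and g :: 'g
    and Km Kp \<Sigma>m \<Sigma>p :: "'s set"
  assumes "lie_group nG G AG"
    and "analytic_manifold nM (Euclidean_space nM) AM"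
    and "pointwise_continuous_action G \<phi>"
    and "non_contractive G nM AM \<phi>"
    and "analytic_1_submanifold nM AM AS \<iota>"
    and "free_curve G \<phi> \<iota>"
    and "is_interval_param D \<upsilon>"
    and "UNIV \<notin> free_segments G \<phi> \<iota>"
    and "z \<in> seg_interior D \<upsilon> UNIV"
    and "z_decomposition G \<phi> \<iota> D \<upsilon> z g Km Kp \<Sigma>m \<Sigma>p"
  defines "case_i \<equiv> \<exists>Cp. boundary_segment Cp \<Sigma>p \<and> Cp \<in> free_segments G \<phi> \<iota> \<and>
      z \<in> seg_boundary D \<upsilon> Cp \<and> Kp \<subseteq> Cp \<and> \<phi> g ` \<iota> ` \<Sigma>m \<subseteq> \<iota> ` Cp \<and>
      analytic_diffeo AS \<Sigma>m Cp (inv_into Cp \<iota> \<circ> (\<phi> g \<circ> \<iota>))"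
    and "case_ii \<equiv> \<exists>Cm. boundary_segment Cm \<Sigma>m \<and> Cm \<in> free_segments G \<phi> \<iota> \<and>
      Cm \<subset> \<Sigma>m \<and> z \<in> seg_boundary D \<upsilon> Cm \<and> Km \<subseteq> Cm \<and> \<phi> g ` \<iota> ` Cm \<subseteq> \<iota> ` \<Sigma>p \<and>
      analytic_diffeo AS Cm \<Sigma>p (inv_into \<Sigma>p \<iota> \<circ> (\<phi> g \<circ> \<iota>))"
  shows "(case_i \<or> case_ii) \<and> \<not> (case_i \<and> case_ii)"
proof -

  \<comment> \<open>The data of the decomposition\<close>
  note lie = assms(1) and B = assms(2) and act = assms(3) and sub = assms(5) and par = assms(7)
    and zdec = assms(10)
  interpret group_action G UNIV \<phi>
    using act by (simp add: pointwise_continuous_action_def)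
  have carr: "carrier G = UNIV" using lie by (simp add: lie_group_def)
  define \<psi> where "\<psi> = \<phi> g"
  define \<psi>' where "\<psi>' = \<phi> (inv\<^bsub>G\<^esub> g)"
  have an: "analytic_map_on nM AM nM AM UNIV (\<phi> k)" for k
    using assms(4) carr by (simp add: non_contractive_def analytic_in_space_def)
  then have \<psi>: "analytic_map_on nM AM nM AM UNIV \<psi>" and \<psi>': "analytic_map_on nM AM nM AM UNIV \<psi>'"
    by (simp_all add: \<psi>_def \<psi>'_def)
  have \<psi>inv: "\<psi>' (\<psi> x) = x" for x
    using orbit_sym_aux[of g x "\<psi> x"] carr by (simp add: \<psi>_def \<psi>'_def)
  have inj\<psi>: "inj \<psi>" using \<psi>inv by (rule inj_on_inverseI)
  have Ach: "analytic_manifold 1 (Half_space 1) AS" and inj\<iota>: "inj \<iota>"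
    and \<iota>an: "analytic_map_on 1 AS nM AM UNIV \<iota>" and \<iota>im: "immersive_on AS nM AM UNIV \<iota>"
    and conS: "connected (UNIV :: 's set)"
    using sub by (auto simp: analytic_1_submanifold_def)
  have \<iota>c: "continuous_on UNIV \<iota>" and \<psi>c: "continuous_on UNIV \<psi>"
    using analytic_map_onD(1) \<iota>an \<psi> by blast+

  have gz: "\<psi> (\<iota> z) = \<iota> z" and Km: "segment Km" "compact Km" and Kp: "segment Kp" "compact Kp"
    and KK: "\<psi> ` \<iota> ` Km = \<iota> ` Kp" and Kint: "Km \<inter> Kp = {z}"
    and bm: "boundary_segment \<Sigma>m UNIV" and bp: "boundary_segment \<Sigma>p UNIV"
    and fm: "\<Sigma>m \<in> free_segments G \<phi> \<iota>" and fp: "\<Sigma>p \<in> free_segments G \<phi> \<iota>"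
    and un: "\<Sigma>m \<union> \<Sigma>p = UNIV" and int: "\<Sigma>m \<inter> \<Sigma>p = {z}"
    and bd: "seg_boundary D \<upsilon> \<Sigma>m \<inter> seg_boundary D \<upsilon> \<Sigma>p = {z}"
    and Km\<Sigma>: "Km \<subseteq> \<Sigma>m" and Kp\<Sigma>: "Kp \<subseteq> \<Sigma>p"
    using zdec by (auto simp: z_decomposition_def stabilizer_def \<psi>_def)
  have "segment \<Sigma>m" "segment \<Sigma>p" using bm bp by (auto simp: boundary_segment_def)
  then obtain am ap where con: "connected \<Sigma>m" "connected \<Sigma>p" and a: "am \<in> \<Sigma>m" "am \<noteq> z" "ap \<in> \<Sigma>p" "ap \<noteq> z"
    unfolding segment_def by metis
  interpret analytic_curve nM AM AS \<iota>
    using B Ach \<iota>an \<iota>im islimpt_connected[OF conS, of _ am z] a by unfold_locales auto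
  obtain I and \<gamma> :: "real \<Rightarrow> 's" and \<gamma>' where I: "is_interval I" and \<gamma>: "homeomorphism I UNIV \<gamma> \<gamma>'" and I0: "0 \<in> I"
    and \<gamma>0: "\<gamma> 0 = z" and \<Sigma>m: "\<Sigma>m = \<gamma> ` (I \<inter> {..0})" and \<Sigma>p: "\<Sigma>p = \<gamma> ` (I \<inter> {0..})"
    using interval_splitting_at_point[OF par con un int a] by blast
  have c\<gamma>: "continuous_on I \<gamma>" and c\<gamma>': "continuous_on UNIV \<gamma>'"
    and inv: "\<And>t. t \<in> I \<Longrightarrow> \<gamma>' (\<gamma> t) = t" "\<And>x. \<gamma> (\<gamma>' x) = x" and \<gamma>'I: "\<And>x. \<gamma>' x \<in> I"
    using \<gamma> by (auto simp: homeomorphism_def)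
  have inj\<gamma>: "inj_on \<gamma> I" using inv(1) by (rule inj_on_inverseI)
  have memI: "t \<in> I" if "s \<in> I" "u \<in> I" "s \<le> t" "t \<le> u" for s t u
    using mem_is_interval_1_I[OF I that] .

  \<comment> \<open>Parameter intervals of the two halves\<close>
  define P where "P = {t. 0 \<le> t \<and> - t \<in> I}"
  define Q where "Q = {t. 0 \<le> t \<and> t \<in> I}"
  define p where "p = (\<lambda>t. \<psi> (\<iota> (\<gamma> (- t))))"
  define q where "q = (\<lambda>t. \<iota> (\<gamma> t))"
  have "t \<in> P" if "s \<in> P" "u \<in> P" "s \<le> t" "t \<le> u" for s t u
    using memI[of "- u" "- s" "- t"] that by (simp add: P_def)
  then have P: "is_interval P" "P \<subseteq> {0..}" "0 \<in> P"
    using I0 unfolding is_interval_1 by (blast, auto simp: P_def)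
  have "t \<in> Q" if "s \<in> Q" "u \<in> Q" "s \<le> t" "t \<le> u" for s t u
    using memI[of s u t] that by (simp add: Q_def)
  then have Q: "is_interval Q" "Q \<subseteq> {0..}" "0 \<in> Q"
    using I0 unfolding is_interval_1 by (blast, auto simp: Q_def)
  have \<Sigma>mP: "\<Sigma>m = (\<lambda>t. \<gamma> (- t)) ` P"
  proof -
    have "I \<inter> {..0} = uminus ` P"
    proof (intro equalityI subsetI)
      fix t assume "t \<in> I \<inter> {..0}"
      then show "t \<in> uminus ` P" by (intro image_eqI[of _ _ "- t"]) (auto simp: P_def)
    qed (auto simp: P_def)
    then show ?thesis using \<Sigma>m by (simp add: image_image)
  qed
  have \<Sigma>pQ: "\<Sigma>p = \<gamma> ` Q"
  proof -
    have "I \<inter> {0..} = Q" by (auto simp: Q_def)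
    then show ?thesis using \<Sigma>p by simp
  qed
  have c\<gamma>P: "continuous_on P (\<lambda>t. \<gamma> (- t))"
    by (rule continuous_on_compose2[OF c\<gamma>]) (auto simp: P_def intro!: continuous_intros)
  have cp: "continuous_on P p"
    unfolding p_def
    by (rule continuous_on_compose2[OF \<psi>c continuous_on_compose2[OF \<iota>c c\<gamma>P]]) auto
  have ip: "inj_on p P"
  proof (rule inj_onI)
    fix s t assume st: "s \<in> P" "t \<in> P" "p s = p t"
    then have "\<gamma> (- s) = \<gamma> (- t)" using inj\<psi> inj\<iota> by (simp add: p_def inj_eq)
    then show "s = t" using inj_onD[OF inj\<gamma>, of "- s" "- t"] st by (simp add: P_def)
  qed
  have QI: "Q \<subseteq> I" by (auto simp: Q_def)
  have cq: "continuous_on Q q"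
    unfolding q_def by (rule continuous_on_compose2[OF \<iota>c continuous_on_subset[OF c\<gamma> QI]]) auto
  have iq: "inj_on q Q"
    using comp_inj_on[OF inj_on_subset[OF inj\<gamma> QI] inj_on_subset[OF inj\<iota> subset_UNIV]] by (simp add: q_def o_def)
  have pq: "p 0 = q 0" by (simp add: p_def q_def \<gamma>0 gz)

  \<comment> \<open>The initial lift from \<open>Km\<close> to \<open>Kp\<close>\<close>
  have negP: "- \<gamma>' x \<in> P" if "x \<in> \<Sigma>m" for x
    using that inv(1) \<gamma>'I by (auto simp: P_def \<Sigma>m)
  \<comment> \<open>In the reversed parameter \<open>Km\<close> is a compact interval. It contains
    \<open>0\<close>, the parameter of \<open>z\<close>, and no negative number, so it starts at
    \<open>0\<close>; a second point of \<open>Km\<close> makes \<open>k\<close> positive.\<close>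
  obtain k where k: "k > 0" "(\<lambda>x. - \<gamma>' x) ` Km = {0..k}"
  proof -
    have c: "continuous_on Km (\<lambda>x. - \<gamma>' x)"
      by (intro continuous_intros continuous_on_subset[OF c\<gamma>']) auto
    have "connected Km" using Km(1) by (simp add: segment_def)
    then have "connected ((\<lambda>x. - \<gamma>' x) ` Km) \<and> compact ((\<lambda>x. - \<gamma>' x) ` Km)"
      using connected_continuous_image[OF c] compact_continuous_image[OF c Km(2)] by simp
    then obtain l u where lu: "(\<lambda>x. - \<gamma>' x) ` Km = {l..u}"
      unfolding connected_compact_interval_1 by blast
    obtain w where w: "w \<in> Km" "w \<noteq> z" using Km(1) unfolding segment_def by metis
    have "z \<in> Km" using Kint by blast
    have \<gamma>'z: "\<gamma>' z = 0" using inv(1)[OF I0] \<gamma>0 by simp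
    have "- \<gamma>' z \<in> {l..u}" unfolding lu[symmetric] using \<open>z \<in> Km\<close> by (rule imageI)
    then have "0 \<in> {l..u}" by (simp add: \<gamma>'z)
    moreover have "{l..u} \<subseteq> {0..}"
      unfolding lu[symmetric]
    proof (rule image_subsetI)
      fix x assume "x \<in> Km"
      then show "- \<gamma>' x \<in> {0..}" using negP[OF subsetD[OF Km\<Sigma>]] P(2) by blast
    qed
    ultimately have l: "l = 0" "0 \<le> u" by auto
    have "\<gamma>' w \<noteq> 0" using inv(2)[of w] w(2) \<gamma>0 by metis
    moreover have "- \<gamma>' w \<in> {l..u}" using lu w(1) by blast
    ultimately show thesis using that[of u] lu l by auto
  qed
  have kP: "k \<in> P"
  proof -
    have "k \<in> (\<lambda>x. - \<gamma>' x) ` Km" using k by auto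
    then show ?thesis using negP Km\<Sigma> by blast
  qed
  have \<gamma>Km: "\<gamma> (- t) \<in> Km" if t: "t \<in> {0..k}" for t
  proof -
    obtain x where "x \<in> Km" "t = - \<gamma>' x" using k(2) t by blast
    then show ?thesis using inv(2) by simp
  qed
  have Km\<gamma>: "x \<in> (\<lambda>t. \<gamma> (- t)) ` {0..k}" if "x \<in> Km" for x
  proof (rule image_eqI)
    show "x = \<gamma> (- (- \<gamma>' x))" using inv(2)[of x] by simp
    show "- \<gamma>' x \<in> {0..k}" unfolding k(2)[symmetric] using that by (rule imageI)
  qed

  \<comment> \<open>Compactness of \<open>Kp\<close> makes the inverse of \<open>\<iota>\<close>
    continuous there, which yields a continuous first piece of the lift.\<close>
  obtain \<kappa> where "homeomorphism Kp (\<iota> ` Kp) \<iota> \<kappa>"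
    using homeomorphism_compact[OF Kp(2) continuous_on_subset[OF \<iota>c] refl inj_on_subset[OF inj\<iota>]] by blast
  then have \<kappa>: "continuous_on (\<iota> ` Kp) \<kappa>" "\<And>y. y \<in> \<iota> ` Kp \<Longrightarrow> \<kappa> y \<in> Kp \<and> \<iota> (\<kappa> y) = y"
    by (auto simp: homeomorphism_def)
  have pKp: "p t \<in> \<iota> ` Kp" if "t \<in> {0..k}" for t
    using \<gamma>Km[OF that] KK by (auto simp: p_def)
  define h0 where "h0 = (\<lambda>t. \<gamma>' (\<kappa> (p t)))"
  have kP': "{0..k} \<subseteq> P" using mem_is_interval_1_I[OF P(1,3) kP] by auto
  have "continuous_on {0..k} (\<lambda>t. \<kappa> (p t))"
    by (rule continuous_on_compose2[OF \<kappa>(1) continuous_on_subset[OF cp kP']]) (use pKp in auto)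
  then have ch0: "continuous_on {0..k} h0"
    unfolding h0_def by (rule continuous_on_compose2[OF c\<gamma>']) auto
  have h0Q: "h0 ` {0..k} \<subseteq> Q"
  proof (rule image_subsetI)
    fix t assume "t \<in> {0..k}"
    then have "\<kappa> (p t) \<in> \<gamma> ` Q" using \<kappa>(2) pKp Kp\<Sigma> \<Sigma>pQ by blast
    then show "h0 t \<in> Q" using inv(1) QI by (auto simp: h0_def)
  qed
  have h0q: "p t = q (h0 t)" if "t \<in> {0..k}" for t
    using \<kappa>(2)[OF pKp[OF that]] inv(2) by (simp add: h0_def q_def)

  \<comment> \<open>The maximal lift and its analytic regularity\<close>
  obtain E h where E: "E \<subseteq> P" "is_interval E" "{0..k} \<subseteq> E" and ch: "continuous_on E h"
    and h: "strict_mono_on E h" "h 0 = 0" "h ` E \<subseteq> Q" "\<And>t. t \<in> E \<Longrightarrow> p t = q (h t)"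
    and alt: "E = P \<or> h ` E = Q"
  proof (rule maximal_reparametrisation[OF P Q cp ip cq iq pq kP k(1) ch0 h0Q h0q])
    fix a a1 b1 :: real and h
    assume a: "0 < a" "a < a1" "a1 \<in> P" "0 < h a" "h a < b1" "b1 \<in> Q"
      and h: "continuous_on {0..a} h" "h ` {0..a} \<subseteq> Q" "\<And>t. t \<in> {0..a} \<Longrightarrow> p t = q (h t)"
    have subI: "{- a1..b1} \<subseteq> I"
      using memI[of "- a1" b1] a by (auto simp: P_def Q_def)
    obtain a' h' where a': "a < a'" "a' \<le> a1" "continuous_on {a..a'} h'" "h' ` {a..a'} \<subseteq> {0..b1}"
      "\<And>t. t \<in> {a..a'} \<Longrightarrow> p t = q (h' t)"
      using reparametrisation_extends[OF \<psi> \<gamma> subI a(1,2,4,5) h(1) order_trans[OF h(2) QI]] h(3)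
      unfolding p_def q_def by blast
    have "a' \<in> P" using mem_is_interval_1_I[OF P(1,3) a(3)] a a' by simp
    moreover have "{0..b1} \<subseteq> Q" using mem_is_interval_1_I[OF Q(1,3) a(6)] by auto
    ultimately show "\<exists>a'>a. \<exists>h'. a' \<in> P \<and> continuous_on {a..a'} h' \<and> h' ` {a..a'} \<subseteq> Q \<and>
        (\<forall>t\<in>{a..a'}. p t = q (h' t))"
      using a' by (meson order_trans)
  qed blast+

  define Cm where "Cm = (\<lambda>t. \<gamma> (- t)) ` E"
  define Cp where "Cp = \<gamma> ` h ` E"
  define f where "f = inv_into Cp \<iota> \<circ> (\<phi> g \<circ> \<iota>)"
  have k0: "0 \<in> E" "k \<in> E" using E(3) k(1) by auto
  have hI: "h t \<in> I" "0 \<le> h t" if "t \<in> E" for t using h(3) that by (auto simp: Q_def)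
  have mI: "- t \<in> I" "0 \<le> t" if "t \<in> E" for t using E(1) that by (auto simp: P_def)
  have lift: "\<psi> (\<iota> (\<gamma> (- t))) = \<iota> (\<gamma> (h t))" if "t \<in> E" for t
    using h(4)[OF that] by (simp add: p_def q_def)
  have f\<gamma>: "f (\<gamma> (- t)) = \<gamma> (h t)" if "t \<in> E" for t
  proof -
    have "inv_into Cp \<iota> (\<iota> (\<gamma> (h t))) = \<gamma> (h t)"
      by (rule inv_into_f_f) (use inj\<iota> that in \<open>auto simp: Cp_def intro: inj_on_subset\<close>)
    then show ?thesis using lift[OF that] by (simp add: f_def \<psi>_def)
  qed
  have inth: "is_interval (h ` E)"
    using connected_continuous_image[OF ch] E(2) by (simp add: is_interval_connected_1)
  obtain h' where h': "homeomorphism E (h ` E) h h'"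
    using injective_into_1d_eq_homeomorphism[OF ch] E(2) strict_mono_on_imp_inj_on[OF h(1)]
      is_interval_path_connected by blast
  have hom: "homeomorphism Cm Cp f (\<lambda>y. \<gamma> (- h' (\<gamma>' y)))"
  proof (rule homeomorphismI)
    have h'E: "h' (h t) = t" if "t \<in> E" for t using h' that by (simp add: homeomorphism_def)
    show "continuous_on Cm f"
    proof -
      have "continuous_on Cm (\<lambda>x. - \<gamma>' x)"
        by (intro continuous_intros continuous_on_subset[OF c\<gamma>']) auto
      then have "continuous_on Cm (\<lambda>x. h (- \<gamma>' x))"
        by (rule continuous_on_compose2[OF ch]) (auto simp: Cm_def inv(1) mI)
      then have "continuous_on Cm (\<lambda>x. \<gamma> (h (- \<gamma>' x)))"
        by (rule continuous_on_compose2[OF c\<gamma>]) (auto simp: Cm_def inv(1) mI hI)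
      then show ?thesis
        by (rule continuous_on_eq) (auto simp: Cm_def f\<gamma> inv(1) mI)
    qed
    show "continuous_on Cp (\<lambda>y. \<gamma> (- h' (\<gamma>' y)))"
    proof -
      have "continuous_on (h ` E) h'" using h' by (simp add: homeomorphism_def)
      then have "continuous_on Cp (\<lambda>y. h' (\<gamma>' y))"
        by (rule continuous_on_compose2) (auto simp: Cp_def inv(1) hI intro: continuous_on_subset[OF c\<gamma>'])
      then have "continuous_on Cp (\<lambda>y. - h' (\<gamma>' y))" by (rule continuous_on_minus)
      then show ?thesis
        by (rule continuous_on_compose2[OF c\<gamma>]) (auto simp: Cp_def inv(1) hI h'E mI)
    qed
  qed (use h' in \<open>auto simp: Cm_def Cp_def f\<gamma> inv(1) hI mI homeomorphism_def\<close>)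
  have \<iota>f: "\<psi> (\<iota> x) = \<iota> (f x)" if "x \<in> Cm" for x
    using that lift f\<gamma> by (auto simp: Cm_def)
  have segm: "segment Cm"
    unfolding segment_def
  proof
    have "continuous_on E (\<lambda>t. \<gamma> (- t))" by (rule continuous_on_subset[OF c\<gamma>P E(1)])
    then show "connected Cm"
      unfolding Cm_def using E(2) by (intro connected_continuous_image) (simp_all add: is_interval_connected_1)
    have "\<gamma> (- 0) \<noteq> \<gamma> (- k)" using inj_onD[OF inj\<gamma>, of "- 0" "- k"] mI k0 k(1) I0 by auto
    then show "\<exists>x\<in>Cm. \<exists>y\<in>Cm. x \<noteq> y" using k0 unfolding Cm_def by blast
  qed
  have segp: "segment Cp"
    unfolding segment_def
  proof
    have "continuous_on (h ` E) \<gamma>" by (rule continuous_on_subset[OF c\<gamma>]) (use hI in auto)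
    then show "connected Cp"
      unfolding Cp_def using inth by (rule connected_continuous_image[OF _ is_interval_connected])
    have "h 0 < h k" using h(1) k0 k(1) by (auto simp: strict_mono_on_def)
    then have "\<gamma> (h 0) \<noteq> \<gamma> (h k)" using inj_onD[OF inj\<gamma>, of "h 0" "h k"] hI k0 by auto
    then show "\<exists>x\<in>Cp. \<exists>y\<in>Cp. x \<noteq> y" using k0 unfolding Cp_def by blast
  qed
  have diffeo: "analytic_diffeo AS Cm Cp f"
    by (rule lift_diffeo[OF \<psi> \<psi>' \<psi>inv hom \<iota>f segm])
  have Cm\<Sigma>: "Cm \<subseteq> \<Sigma>m" using E(1) by (auto simp: Cm_def \<Sigma>mP)
  have Cp\<Sigma>: "Cp \<subseteq> \<Sigma>p" using h(3) by (auto simp: Cp_def \<Sigma>pQ)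
  have zC: "z \<in> Cm" "z \<in> Cp" using k0(1) h(2) \<gamma>0 by (force simp: Cm_def Cp_def)+
  \<comment> \<open>Interiors grow with the set, so a boundary point of \<open>\<Sigma>\<close>
    stays a boundary point of every smaller piece that contains it.\<close>
  have bdz: "z \<in> seg_boundary D \<upsilon> C" if "C \<subseteq> \<Sigma>" "z \<in> C" "z \<in> seg_boundary D \<upsilon> \<Sigma>" for C \<Sigma>
  proof -
    have "interior (D \<inter> \<upsilon> -` C) \<subseteq> interior (D \<inter> \<upsilon> -` \<Sigma>)"
      by (rule interior_mono) (use that in auto)
    then show ?thesis using that by (auto simp: seg_boundary_def seg_interior_def)
  qed
  have free: "C \<in> free_segments G \<phi> \<iota>" if "segment C" "C \<subseteq> \<Sigma>" "\<Sigma> \<in> free_segments G \<phi> \<iota>" for C \<Sigma>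
    by (rule free_segments_subset[OF I \<gamma> \<iota>c inj\<iota> that(3,1,2)])
  have img: "\<phi> g ` \<iota> ` Cm \<subseteq> \<iota> ` Cp"
    using lift by (auto simp: Cm_def Cp_def \<psi>_def)
  have KmC: "Km \<subseteq> Cm"
    using Km\<gamma> E(3) unfolding Cm_def by blast
  have KpC: "Kp \<subseteq> Cp"
  proof
    fix v assume "v \<in> Kp"
    then obtain u where "u \<in> Km" "\<iota> v = \<psi> (\<iota> u)" using KK by blast
    then have "\<iota> v \<in> \<iota> ` Cp" using img KmC unfolding \<psi>_def by blast
    then obtain w where "w \<in> Cp" "\<iota> v = \<iota> w" by blast
    then show "v \<in> Cp" using inj\<iota> by (simp add: inj_eq)
  qed
  \<comment> \<open>Removing an interval that starts at the left end \<open>0\<close> leaves an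
    interval; this is why \<open>Cm\<close> and \<open>Cp\<close> are boundary segments.\<close>
  have initial: "connected (\<delta> ` R - \<delta> ` T)"
    if R: "is_interval R" and T: "is_interval T" "T \<subseteq> R" "0 \<in> T" "R \<subseteq> {0..}" and \<delta>: "continuous_on R \<delta>" "inj_on \<delta> R"
    for R T and \<delta> :: "real \<Rightarrow> 's"
  proof -
    have "is_interval (R - T)"
      unfolding is_interval_1
    proof (intro ballI allI impI)
      fix s u t assume st: "s \<in> R - T" "u \<in> R - T" "s \<le> t \<and> t \<le> u"
      then have "t \<in> R" using mem_is_interval_1_I[OF R] by blast
      moreover have "t \<notin> T"
        using mem_is_interval_1_I[OF T(1,3), of t s] st T(4) by auto
      ultimately show "t \<in> R - T" by simp
    qed
    then have "connected (\<delta> ` (R - T))"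
      using continuous_on_subset[OF \<delta>(1)] by (intro connected_continuous_image) (auto simp: is_interval_connected_1)
    moreover have "\<delta> ` (R - T) = \<delta> ` R - \<delta> ` T"
      using inj_on_image_set_diff[OF \<delta>(2)] T(2) by blast
    ultimately show ?thesis by simp
  qed

  \<comment> \<open>The two cases and their exclusion\<close>
  have "case_i \<or> case_ii"
  proof (cases "E = P")
    case True
    then have Cm: "Cm = \<Sigma>m" by (simp add: Cm_def \<Sigma>mP)
    have "connected (\<Sigma>p - Cp)"
      unfolding \<Sigma>pQ Cp_def using initial[OF Q(1) inth h(3) _ Q(2) continuous_on_subset[OF c\<gamma> QI] inj_on_subset[OF inj\<gamma> QI]] k0(1) h(2)
      by force
    then have "boundary_segment Cp \<Sigma>p" using segp Cp\<Sigma> by (simp add: boundary_segment_def)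
    then have case_i
      unfolding case_i_def
      using free[OF segp Cp\<Sigma> fp] bdz[OF Cp\<Sigma> zC(2)] bd KpC img diffeo Cm unfolding f_def by blast
    then show ?thesis ..
  next
    case False
    then have hE: "h ` E = Q" using alt by blast
    then have Cp: "Cp = \<Sigma>p" by (simp add: Cp_def \<Sigma>pQ)
    have i\<gamma>P: "inj_on (\<lambda>t. \<gamma> (- t)) P"
    proof (rule inj_onI)
      fix s t assume "s \<in> P" "t \<in> P" "\<gamma> (- s) = \<gamma> (- t)"
      then show "s = t" using inj_onD[OF inj\<gamma>, of "- s" "- t"] by (simp add: P_def)
    qed
    have "connected (\<Sigma>m - Cm)"
      unfolding \<Sigma>mP Cm_def using initial[OF P(1) E(2,1) k0(1) P(2) c\<gamma>P i\<gamma>P] .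
    then have "boundary_segment Cm \<Sigma>m" using segm Cm\<Sigma> by (simp add: boundary_segment_def)
    \<comment> \<open>Properness in the second case comes from treating \<open>E = P\<close> first:
      when both domain and range are exhausted, the situation is counted as the first case.\<close>
    moreover have "Cm \<noteq> \<Sigma>m"
      using False E(1) inj_on_image_eq_iff[OF i\<gamma>P, of E P] by (simp add: Cm_def \<Sigma>mP)
    ultimately have case_ii
      unfolding case_ii_def
      using free[OF segm Cm\<Sigma> fm] bdz[OF Cm\<Sigma> zC(1)] bd KmC img diffeo Cp Cm\<Sigma> unfolding f_def by blast
    then show ?thesis ..
  qed
  moreover have "\<not> (case_i \<and> case_ii)"
  proof
    assume both: "case_i \<and> case_ii"
    then obtain C1 where C1: "C1 \<subseteq> \<Sigma>p" "\<psi> ` \<iota> ` \<Sigma>m \<subseteq> \<iota> ` C1"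
      unfolding case_i_def boundary_segment_def \<psi>_def by blast
    obtain C2 where C2: "C2 \<subset> \<Sigma>m" "\<psi> ` \<iota> ` C2 \<subseteq> \<iota> ` \<Sigma>p"
      and "analytic_diffeo AS C2 \<Sigma>p (inv_into \<Sigma>p \<iota> \<circ> (\<phi> g \<circ> \<iota>))"
      using both unfolding case_ii_def \<psi>_def by blast
    then have surj: "(inv_into \<Sigma>p \<iota> \<circ> (\<phi> g \<circ> \<iota>)) ` C2 = \<Sigma>p"
      by (auto simp: analytic_diffeo_def homeomorphism_def)
    \<comment> \<open>A point left out by \<open>C2\<close> is still mapped into the image of
      \<open>\<Sigma>p\<close>, by the first case. There the second case already provides a preimage
      \<open>y\<close> in \<open>C2\<close>, against injectivity of \<open>\<psi>\<close> and
      \<open>\<iota>\<close>.\<close>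
    obtain x where x: "x \<in> \<Sigma>m" "x \<notin> C2" using C2 by blast
    then obtain w where w: "w \<in> \<Sigma>p" "\<psi> (\<iota> x) = \<iota> w" using C1 by blast
    then obtain y where y: "y \<in> C2" "w = inv_into \<Sigma>p \<iota> (\<psi> (\<iota> y))"
      using surj unfolding \<psi>_def by force
    then have "\<iota> w = \<psi> (\<iota> y)" using C2(2) f_inv_into_f[of "\<psi> (\<iota> y)" \<iota> \<Sigma>p] by auto
    then have "x = y" using w(2) inj\<psi> inj\<iota> by (metis injD)
    then show False using x y by simp
  qed
  ultimately show ?thesis by blast
qed

end
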